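(* Let $\Omega\subset\mathbb{R}^n$ be a connected, bounded, open set with smooth boundary. For each $\ell\in(0,1)$ let $v_\ell$ be a viscosity solution of $$\min\left\{-\Delta_\infty v_\ell,\ |\nabla v_\ell|-\lambda_{1,\infty}(\Omega)\,v_\ell^{\ell}\right\}=0\ \text{ in }\Omega,\qquad v_\ell=0\ \text{ on }\partial\Omega,$$ with $\|v_\ell\|_{L^\infty(\Omega)}=1$. Then there exists a function $\widehat v\in W^{1,\infty}_0(\Omega)\cap C(\overline\Omega)$ such that $$\lim_{\ell\nearrow1}v_\ell(x)=\widehat v(x)\quad\text{uniformly in }\overline\Omega,$$ and $\widehat v$ is an eigenfunction for the $\infty$-eigenvalue problem, i.e. a viscosity solution of $$\min\left\{-\Delta_\infty v,\ |\nabla v|-\lambda_{1,\infty}(\Omega)\,v\right\}=0\ \text{ in }\Omega,\qquad v=0\ \text{ on }\partial\Omega,\qquad (\ast)$$ normalized with $\|\widehat v\|_{L^\infty(\Omega)}=1$. Furthermore, $\widehat v$ is the maximal solution of $(\ast)$ in the following sense: $\widehat v\ge u_\infty$ for any other viscosity solution $u_\infty$ of $(\ast)$ with $\|u_\infty\|_{L^\infty(\Omega)}=1$.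
   Context: $\Delta_\infty u=\sum_{i,j=1}^n \frac{\partial u}{\partial x_j}\frac{\partial^2u}{\partial x_j\partial x_i}\frac{\partial u}{\partial x_i}$. $\lambda_{1,\infty}(\Omega)=\inf_{u\in W^{1,\infty}_0(\Omega)\setminus\{0\}}\|\nabla u\|_{L^\infty(\Omega)}/\|u\|_{L^\infty(\Omega)}$, which equals $1/\mathfrak{R}$ with $\mathfrak{R}$ the radius of the biggest ball contained in $\Omega$. For $\ell\in(0,1]$, a non-negative $u\in C(\Omega)$ is a viscosity solution of $\min\{-\Delta_\infty u,\ |\nabla u|-\lambda_{1,\infty}(\Omega)u^\ell\}=0$ in $\Omega$ if: (1) whenever $x_0\in\Omega$ and $\phi\in C^2(\Omega)$ satisfy $u(x_0)=\phi(x_0)$ and $u(x)<\phi(x)$ for $x\neq x_0$, then $-\Delta_\infty\phi(x_0)\le0$ or $|\nabla\phi(x_0)|-\lambda_{1,\infty}(\Omega)\phi^\ell(x_0)\le0$; (2) whenever $x_0\in\Omega$ and $\phi\in C^2(\Omega)$ satisfy $u(x_0)=\phi(x_0)$ and $u(x)>\phi(x)$ for $x\neq x_0$, then $-\Delta_\infty\phi(x_0)\ge0$ and $|\nabla\phi(x_0)|-\lambda_{1,\infty}(\Omega)\phi^\ell(x_0)\ge0$. The case $\ell=1$ is the notion of solution for $(\ast)$. The boundary condition means that $u$ extends continuously to $\overline\Omega$ with value $0$ on $\partial\Omega$. *)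

theory Defs
  imports "HOL-Analysis.Analysis" "HOL-Probability.Essential_Supremum"
begin

definition partial_deriv :: "'a::euclidean_space \<Rightarrow> ('a \<Rightarrow> real) \<Rightarrow> 'a \<Rightarrow> real" where
  "partial_deriv i f x = frechet_derivative f (at x) i"

definition grad :: "('a::euclidean_space \<Rightarrow> real) \<Rightarrow> 'a \<Rightarrow> 'a" where
  "grad f x = (\<Sum>i\<in>Basis. partial_deriv i f x *\<^sub>R i)"

(* The class C^k(S); only meant for open S. *)
primrec Ck_on :: "nat \<Rightarrow> 'a set \<Rightarrow> ('a::euclidean_space \<Rightarrow> real) \<Rightarrow> bool" where
  "Ck_on 0 S f \<longleftrightarrow> continuous_on S f"
| "Ck_on (Suc k) S f \<longleftrightarrow>
     (\<forall>x\<in>S. f differentiable (at x)) \<and> (\<forall>i\<in>Basis. Ck_on k S (partial_deriv i f))"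

definition smooth_on :: "'a set \<Rightarrow> ('a::euclidean_space \<Rightarrow> real) \<Rightarrow> bool" where
  "smooth_on S f \<longleftrightarrow> (\<forall>k. Ck_on k S f)"

definition inf_laplacian :: "('a::euclidean_space \<Rightarrow> real) \<Rightarrow> 'a \<Rightarrow> real" where
  "inf_laplacian u x =
     (\<Sum>i\<in>Basis. \<Sum>j\<in>Basis.
        partial_deriv j u x * partial_deriv j (partial_deriv i u) x * partial_deriv i u x)"

(* Near each boundary point, after relabelling and reorienting the coordinate axes, the set is the
   region above the graph of a smooth function of the other coordinates. The vector e is the
   distinguished (possibly reversed) axis and y - (y \<bullet> e) e is the projection of y to the other
   coordinates, so only the values of \<gamma> on the hyperplane orthogonal to e matter. *)
definition smooth_boundary :: "'a::euclidean_space set \<Rightarrow> bool" where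
  "smooth_boundary \<Omega> \<longleftrightarrow>
     (\<forall>x\<in>frontier \<Omega>. \<exists>r>0. \<exists>e \<gamma>. (e \<in> Basis \<or> - e \<in> Basis) \<and> smooth_on UNIV \<gamma> \<and>
        \<Omega> \<inter> ball x r = {y \<in> ball x r. \<gamma> (y - (y \<bullet> e) *\<^sub>R e) < y \<bullet> e})"

definition Linf_norm :: "'a::euclidean_space set \<Rightarrow> ('a \<Rightarrow> 'b::real_normed_vector) \<Rightarrow> ennreal" where
  "Linf_norm \<Omega> f = esssup (lebesgue_on \<Omega>) (\<lambda>x. ennreal (norm (f x)))"

definition test_function :: "'a::euclidean_space set \<Rightarrow> ('a \<Rightarrow> real) \<Rightarrow> bool" where
  "test_function \<Omega> \<phi> \<longleftrightarrow>
     smooth_on UNIV \<phi> \<and> compact (closure {x. \<phi> x \<noteq> 0}) \<and> closure {x. \<phi> x \<noteq> 0} \<subseteq> \<Omega>"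

(* Only used for u and g in L^\<infinity>, where both integrands are integrable. *)
definition weak_grad :: "'a::euclidean_space set \<Rightarrow> ('a \<Rightarrow> real) \<Rightarrow> ('a \<Rightarrow> 'a) \<Rightarrow> bool" where
  "weak_grad \<Omega> u g \<longleftrightarrow>
     (\<forall>\<phi>. test_function \<Omega> \<phi> \<longrightarrow> (\<forall>i\<in>Basis.
        (LINT x|lebesgue_on \<Omega>. u x * partial_deriv i \<phi> x) =
        - (LINT x|lebesgue_on \<Omega>. (g x \<bullet> i) * \<phi> x)))"

definition Linf :: "'a::euclidean_space set \<Rightarrow> ('a \<Rightarrow> 'b::real_normed_vector) \<Rightarrow> bool" where
  "Linf \<Omega> f \<longleftrightarrow> f \<in> borel_measurable (lebesgue_on \<Omega>) \<and> Linf_norm \<Omega> f < \<infinity>"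

definition W1inf :: "'a::euclidean_space set \<Rightarrow> ('a \<Rightarrow> real) \<Rightarrow> bool" where
  "W1inf \<Omega> u \<longleftrightarrow> Linf \<Omega> u \<and> (\<exists>g. Linf \<Omega> g \<and> weak_grad \<Omega> u g)"

(* Zero boundary values are imposed on the continuous representative, as usual for p = \<infinity>
   (the norm closure of the test functions would contain only C^1 functions). *)
definition W1inf0 :: "'a::euclidean_space set \<Rightarrow> ('a \<Rightarrow> real) \<Rightarrow> bool" where
  "W1inf0 \<Omega> u \<longleftrightarrow> W1inf \<Omega> u \<and>
     (\<exists>w. continuous_on (closure \<Omega>) w \<and> (\<forall>x\<in>frontier \<Omega>. w x = 0) \<and>
          (AE x in lebesgue_on \<Omega>. u x = w x))"

(* The weak gradient g is unique up to null sets, so g ranges over representatives of grad u. *)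
definition lambda_1_inf :: "'a::euclidean_space set \<Rightarrow> real" where
  "lambda_1_inf \<Omega> = Inf {enn2real (Linf_norm \<Omega> g) / enn2real (Linf_norm \<Omega> u) | u g.
     W1inf0 \<Omega> u \<and> \<not> (AE x in lebesgue_on \<Omega>. u x = 0) \<and> Linf \<Omega> g \<and> weak_grad \<Omega> u g}"

definition viscosity_solution :: "'a::euclidean_space set \<Rightarrow> real \<Rightarrow> ('a \<Rightarrow> real) \<Rightarrow> bool" where
  "viscosity_solution \<Omega> l u \<longleftrightarrow>
     continuous_on \<Omega> u \<and> (\<forall>x\<in>\<Omega>. 0 \<le> u x) \<and>
     (\<forall>x0\<in>\<Omega>. \<forall>\<phi>. Ck_on 2 \<Omega> \<phi> \<and> u x0 = \<phi> x0 \<and> (\<forall>x\<in>\<Omega> - {x0}. u x < \<phi> x) \<longrightarrow>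
        - inf_laplacian \<phi> x0 \<le> 0 \<or>
        norm (grad \<phi> x0) - lambda_1_inf \<Omega> * (\<phi> x0 powr l) \<le> 0) \<and>
     (\<forall>x0\<in>\<Omega>. \<forall>\<phi>. Ck_on 2 \<Omega> \<phi> \<and> u x0 = \<phi> x0 \<and> (\<forall>x\<in>\<Omega> - {x0}. u x > \<phi> x) \<longrightarrow>
        - inf_laplacian \<phi> x0 \<ge> 0 \<and>
        norm (grad \<phi> x0) - lambda_1_inf \<Omega> * (\<phi> x0 powr l) \<ge> 0)"

(* Here u stands for its own continuous extension to the closure of \<Omega>. *)
definition dirichlet_solution :: "'a::euclidean_space set \<Rightarrow> real \<Rightarrow> ('a \<Rightarrow> real) \<Rightarrow> bool" where
  "dirichlet_solution \<Omega> l u \<longleftrightarrow>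
     viscosity_solution \<Omega> l u \<and> continuous_on (closure \<Omega>) u \<and> (\<forall>x\<in>frontier \<Omega>. u x = 0)"

end

theory Submission
  imports Defs
begin

text \<open>
  Write \<open>\<Lambda>\<close> for \<open>lambda_1_inf \<Omega>\<close>. The whole argument runs on comparison with radial barriers.

  \<^emph>\<open>Cones.\<close> Away from its vertex, an upward cone of slope \<open>K \<ge> \<Lambda> u\<^sup>l\<close> is a supersolution, and every
  downward cone is infinity-harmonic. Bending a cone slightly makes the inequalities strict, so a solution
  \<open>u\<close> stays below the former and above the latter (\<open>subsolution_below_cone\<close>,
  \<open>supersolution_above_cone\<close>). The gradient constraint forces a supersolution to decay by at least
  \<open>r \<Lambda> (min u)\<^sup>l\<close> at distance \<open>r\<close> (\<open>supersolution_decay\<close>). The consequences are that nontrivial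
  solutions are positive inside, that \<open>\<Lambda> > 0\<close>, and that solutions bounded by \<open>1\<close> are Lipschitz
  with constant \<open>\<Lambda>\<close> up to the boundary.

  \<^emph>\<open>Comparison for \<open>l < 1\<close>.\<close> In the variable \<open>u powr (1 - l)\<close> the gradient constraint no longer
  contains \<open>u\<close>, and the infinity-Laplace part becomes strictly monotone in the unknown. In place
  of Hessians of doubled variables the proof of \<open>comparison\<close> compares a subsolution and a
  supersolution at the midpoint of an optimal pair of points, in the finite-difference style of
  Armstrong and Smart: cones give discrete convexity of one function and discrete concavity of the
  other, and a strictly concave change of variables makes the two incompatible.

  \<^emph>\<open>The limit.\<close> For values in \<open>[0, 1]\<close> the term \<open>u powr l\<close> decreases in \<open>l\<close>. Hence the solution for
  a larger exponent, and likewise every normalised infinity-eigenfunction, is a subsolution for a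
  smaller one. Comparison shows that \<open>v l\<close> decreases in \<open>l\<close> and dominates every such
  eigenfunction, so its limit does too: this is the maximality. Equi-Lipschitz bounds make the
  limit uniform, uniform limits of viscosity solutions are viscosity solutions
  (\<open>viscosity_solution_stable\<close>), and the limit lies in \<open>W1inf0\<close> because bounded difference quotients
  of a Lipschitz function have a weak limit (\<open>bounded_weak_limit\<close>, \<open>lipschitz_W1inf\<close>).
\<close>

section \<open>Second-order calculus of test functions\<close>

lemma partial_deriv_eq:
  assumes "(f has_derivative f') (at x)"
  shows "partial_deriv i f x = f' i"
  using frechet_derivative_at[OF assms] by (simp add: partial_deriv_def)

lemma C2_of_second_derivative:
  fixes f :: "'a::euclidean_space \<Rightarrow> real"
  assumes G: "\<And>x. (f has_derivative (\<lambda>h. G x \<bullet> h)) (at x)"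
    and H: "\<And>x. (G has_derivative H x) (at x)"
    and cont: "\<And>h. continuous_on UNIV (\<lambda>x. H x h)"
  shows "Ck_on 2 S f" "grad f x = G x" "inf_laplacian f x = G x \<bullet> H x (G x)"
proof -
  have p1: "partial_deriv i f = (\<lambda>x. G x \<bullet> i)" for i
    using partial_deriv_eq[OF G] by auto
  have d2: "((\<lambda>x. G x \<bullet> i) has_derivative (\<lambda>h. H x h \<bullet> i)) (at x)" for x i
    by (intro has_derivative_inner_left H)
  have p2: "partial_deriv j (\<lambda>x. G x \<bullet> i) = (\<lambda>x. H x j \<bullet> i)" for i j
    using partial_deriv_eq[OF d2] by auto
  have "continuous_on S (\<lambda>x. H x j \<bullet> i)" for i j
    by (intro continuous_intros continuous_on_subset[OF cont]) auto
  then show "Ck_on 2 S f"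
    using differentiableI[OF G] differentiableI[OF d2] by (simp add: numeral_2_eq_2 p1 p2)
  show g: "grad f x = G x"
    by (simp add: grad_def p1 euclidean_representation)
  interpret bounded_linear "H x" using H by (rule has_derivative_bounded_linear)
  have "G x \<bullet> H x (G x) = (\<Sum>i\<in>Basis. (G x \<bullet> i) * (H x (G x) \<bullet> i))"
    by (rule euclidean_inner)
  also have "\<dots> = (\<Sum>i\<in>Basis. (G x \<bullet> i) * (H x (\<Sum>j\<in>Basis. (G x \<bullet> j) *\<^sub>R j) \<bullet> i))"
    by (simp add: euclidean_representation)
  also have "\<dots> = inf_laplacian f x"
    by (simp add: inf_laplacian_def p1 p2 sum scaleR inner_sum_left sum_distrib_left mult_ac)
  finally show "inf_laplacian f x = G x \<bullet> H x (G x)" ..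
qed

text \<open>
  Every barrier in the sequel is a profile of the squared distance to a centre: unlike the
  distance itself it is smooth at the centre, so it yields a test function on the whole domain.
\<close>

lemma C2_radial:
  fixes z :: "'a::euclidean_space"
  assumes g: "\<And>s. (g has_real_derivative g' s) (at s)"
    and g': "\<And>s. (g' has_real_derivative g'' s) (at s)"
    and g'': "continuous_on UNIV g''"
  defines "f \<equiv> \<lambda>x. g ((x - z) \<bullet> (x - z))"
  shows "Ck_on 2 S f"
    "grad f x = (2 * g' ((x - z) \<bullet> (x - z))) *\<^sub>R (x - z)"
    "inf_laplacian f x = (let s = (x - z) \<bullet> (x - z) in
       (2 * g' s)\<^sup>2 * (2 * g' s * s + 4 * g'' s * s\<^sup>2))"
proof -
  define G where "G x = (2 * g' ((x - z) \<bullet> (x - z))) *\<^sub>R (x - z)" for x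
  define H where "H x h = (2 * g' ((x - z) \<bullet> (x - z))) *\<^sub>R h
      + (4 * g'' ((x - z) \<bullet> (x - z)) * ((x - z) \<bullet> h)) *\<^sub>R (x - z)" for x h
  have sq: "((\<lambda>x. (x - z) \<bullet> (x - z)) has_derivative (\<lambda>h. 2 * ((x - z) \<bullet> h))) (at x)" for x
    by (auto intro!: derivative_eq_intros simp: inner_commute algebra_simps)
  have chain: "((\<lambda>x. k ((x - z) \<bullet> (x - z))) has_derivative
      (\<lambda>h. k' ((x - z) \<bullet> (x - z)) * (2 * ((x - z) \<bullet> h)))) (at x)"
    if "\<And>s. (k has_real_derivative k' s) (at s)" for k k' :: "real \<Rightarrow> real" and x
    using has_derivative_compose[OF sq, of k "(*) (k' ((x - z) \<bullet> (x - z)))" x] that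
    by (simp add: has_field_derivative_def)
  have 1: "(f has_derivative (\<lambda>h. G x \<bullet> h)) (at x)" for x
    unfolding f_def G_def using chain[OF g] by (rule has_derivative_eq_rhs) auto
  have 2: "(G has_derivative H x) (at x)" for x
    unfolding G_def H_def
    by (rule derivative_eq_intros chain[OF g'] refl)+ (auto simp: algebra_simps)
  have g'c: "continuous_on UNIV g'"
    using g' by (meson DERIV_continuous continuous_at_imp_continuous_on)
  have 3: "continuous_on UNIV (\<lambda>x. H x h)" for h
    unfolding H_def
    by (intro continuous_intros continuous_on_compose2[OF g'c] continuous_on_compose2[OF g'']) auto
  note C2 = C2_of_second_derivative[OF 1 2 3]
  show "Ck_on 2 S f" by (rule C2(1))
  show "grad f x = (2 * g' ((x - z) \<bullet> (x - z))) *\<^sub>R (x - z)" using C2(2) by (simp add: G_def)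
  show "inf_laplacian f x = (let s = (x - z) \<bullet> (x - z) in
       (2 * g' s)\<^sup>2 * (2 * g' s * s + 4 * g'' s * s\<^sup>2))"
    unfolding C2(3) by (simp add: G_def H_def Let_def inner_add_right power2_eq_square algebra_simps)
qed

lemma has_derivative_cong_open:
  assumes "open S" "x \<in> S" "\<And>y. y \<in> S \<Longrightarrow> f y = g y"
  shows "(f has_derivative D) (at x) \<longleftrightarrow> (g has_derivative D) (at x)"
  using assms by (metis has_derivative_transform_within_open)

lemma partial_deriv_cong_open:
  assumes "open S" "x \<in> S" "\<And>y. y \<in> S \<Longrightarrow> f y = g y"
  shows "partial_deriv i f x = partial_deriv i g x"
  using has_derivative_cong_open[OF assms] by (simp add: partial_deriv_def frechet_derivative_def)

lemma Ck_on_cong: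
  assumes "open S" "\<And>y. y \<in> S \<Longrightarrow> f y = g y"
  shows "Ck_on k S f \<longleftrightarrow> Ck_on k S g"
  using assms(2)
proof (induction k arbitrary: f g)
  case 0
  then show ?case by (auto cong: continuous_on_cong)
next
  case (Suc k)
  have "f differentiable (at x) \<longleftrightarrow> g differentiable (at x)" if "x \<in> S" for x
    using has_derivative_cong_open[OF assms(1) that Suc.prems] by (simp add: differentiable_def)
  moreover have "Ck_on k S (partial_deriv i f) \<longleftrightarrow> Ck_on k S (partial_deriv i g)" for i
    by (rule Suc.IH) (metis partial_deriv_cong_open assms(1) Suc.prems)
  ultimately show ?case by auto
qed

lemma partial_deriv_add:
  assumes "f differentiable (at x)" "g differentiable (at x)"
  shows "partial_deriv i (\<lambda>x. f x + g x) x = partial_deriv i f x + partial_deriv i g x"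
  using partial_deriv_eq[OF has_derivative_add[OF assms[unfolded frechet_derivative_works]]]
  by (simp add: partial_deriv_def)

lemma Ck_on_add:
  assumes "open S" "Ck_on k S f" "Ck_on k S g"
  shows "Ck_on k S (\<lambda>x. f x + g x)"
  using assms(2,3)
proof (induction k arbitrary: f g)
  case 0
  then show ?case by (auto intro: continuous_intros)
next
  case (Suc k)
  have "Ck_on k S (partial_deriv i (\<lambda>x. f x + g x)) \<longleftrightarrow>
      Ck_on k S (\<lambda>x. partial_deriv i f x + partial_deriv i g x)" for i
    using Suc.prems by (intro Ck_on_cong[OF assms(1)] partial_deriv_add) auto
  then show ?case using Suc by (auto intro: differentiable_add)
qed

text \<open>
  The quartic vanishes to third order at the contact point, so it leaves the 2-jet there
  unchanged while turning a contact that is only local into a strict global one.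
\<close>

lemma C2_add_quartic:
  fixes \<phi> :: "'a::euclidean_space \<Rightarrow> real" and c M :: real
  assumes S: "open S" and x0: "x0 \<in> S" and \<phi>: "Ck_on 2 S \<phi>"
  defines "\<psi> \<equiv> \<lambda>x. \<phi> x + (c + M * ((x - x0) \<bullet> (x - x0))\<^sup>2)"
  shows "Ck_on 2 S \<psi>" "grad \<psi> x0 = grad \<phi> x0" "inf_laplacian \<psi> x0 = inf_laplacian \<phi> x0"
proof -
  define q where "q x = c + M * ((x - x0) \<bullet> (x - x0))\<^sup>2" for x :: 'a
  define G where "G x = (4 * M * ((x - x0) \<bullet> (x - x0))) *\<^sub>R (x - x0)" for x
  define H where "H x h = (4 * M * ((x - x0) \<bullet> (x - x0))) *\<^sub>R h
      + (8 * M * ((x - x0) \<bullet> h)) *\<^sub>R (x - x0)" for x h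
  have G: "(q has_derivative (\<lambda>h. G x \<bullet> h)) (at x)" for x
    unfolding q_def G_def by (auto intro!: derivative_eq_intros simp: inner_commute algebra_simps)
  have H: "(G has_derivative H x) (at x)" for x
    unfolding G_def H_def by (auto intro!: derivative_eq_intros simp: inner_commute algebra_simps)
  have Hc: "continuous_on UNIV (\<lambda>x. H x h)" for h
    unfolding H_def by (intro continuous_intros)
  have q2: "Ck_on 2 S q" by (rule C2_of_second_derivative[OF G H Hc])
  have pq: "partial_deriv i q = (\<lambda>x. G x \<bullet> i)" for i
    using partial_deriv_eq[OF G] by auto
  have pq2: "partial_deriv j (partial_deriv i q) x0 = 0" for i j
    unfolding pq using partial_deriv_eq[OF has_derivative_inner_left[OF H], of j i x0]
    by (simp add: H_def)
  have \<psi>: "\<psi> = (\<lambda>x. \<phi> x + q x)" by (simp add: \<psi>_def q_def)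
  show "Ck_on 2 S \<psi>" unfolding \<psi> by (rule Ck_on_add[OF S \<phi> q2])
  have dif: "\<phi> differentiable (at x)" "q differentiable (at x)"
     "i \<in> Basis \<Longrightarrow> partial_deriv i \<phi> differentiable (at x)"
     "i \<in> Basis \<Longrightarrow> partial_deriv i q differentiable (at x)" if "x \<in> S" for x i
    using that \<phi> q2 by (auto simp: numeral_2_eq_2)
  have p: "partial_deriv i \<psi> x = partial_deriv i \<phi> x + partial_deriv i q x" if "x \<in> S" for x i
    unfolding \<psi> using dif that by (intro partial_deriv_add) auto
  have p0: "partial_deriv i \<psi> x0 = partial_deriv i \<phi> x0" for i
    using p[OF x0] by (simp add: pq G_def)
  have "partial_deriv j (partial_deriv i \<psi>) x0
      = partial_deriv j (\<lambda>x. partial_deriv i \<phi> x + partial_deriv i q x) x0" for i j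
    using S x0 p by (rule partial_deriv_cong_open)
  also have "\<dots> i j = partial_deriv j (partial_deriv i \<phi>) x0" if "i \<in> Basis" for i j
    using dif x0 that by (subst partial_deriv_add) (auto simp: pq2)
  finally have "partial_deriv j (partial_deriv i \<psi>) x0 = partial_deriv j (partial_deriv i \<phi>) x0"
    if "i \<in> Basis" for i j using that .
  then show "inf_laplacian \<psi> x0 = inf_laplacian \<phi> x0" by (simp add: inf_laplacian_def p0)
  show "grad \<psi> x0 = grad \<phi> x0" by (simp add: grad_def p0)
qed

section \<open>Touching and comparison with cones\<close>

text \<open>
  The definition asks for strict global contact. Adding a large multiple of the fourth power of
  the distance shows that local contact up to a constant is enough, as long as the test function
  does not fall infinitely far below the solution.
\<close>

lemma viscosity_touch_above:
  fixes u :: "'a::euclidean_space \<Rightarrow> real"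
  assumes \<Omega>: "open \<Omega>" and u: "viscosity_solution \<Omega> l u" and x0: "x0 \<in> \<Omega>" and \<phi>: "Ck_on 2 \<Omega> \<phi>"
    and r: "r > 0" and loc: "\<And>x. x \<in> \<Omega> \<Longrightarrow> dist x x0 < r \<Longrightarrow> u x - \<phi> x \<le> u x0 - \<phi> x0"
    and bd: "\<And>x. x \<in> \<Omega> \<Longrightarrow> u x \<le> \<phi> x + B"
  shows "inf_laplacian \<phi> x0 \<ge> 0 \<or> norm (grad \<phi> x0) \<le> lambda_1_inf \<Omega> * (u x0 powr l)"
proof -
  define c where "c = u x0 - \<phi> x0"
  define M where "M = (\<bar>B - c\<bar> + 1) / r ^ 4"
  define \<psi> where "\<psi> x = \<phi> x + (c + M * ((x - x0) \<bullet> (x - x0))\<^sup>2)" for x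
  note \<psi> = C2_add_quartic[OF \<Omega> x0 \<phi>, of c M, folded \<psi>_def]
  have M: "M > 0" using r by (simp add: M_def)
  have "u x < \<psi> x" if x: "x \<in> \<Omega> - {x0}" for x
  proof (cases "dist x x0 < r")
    case True
    have "M * ((x - x0) \<bullet> (x - x0))\<^sup>2 > 0" using M x by simp
    then show ?thesis using loc[of x] True x by (simp add: \<psi>_def c_def)
  next
    case False
    then have "r\<^sup>2 \<le> (dist x x0)\<^sup>2" using r by (intro power_mono) auto
    then have "r\<^sup>2 \<le> (x - x0) \<bullet> (x - x0)" by (simp add: dist_norm power2_norm_eq_inner)
    then have "(r\<^sup>2)\<^sup>2 \<le> ((x - x0) \<bullet> (x - x0))\<^sup>2" by (intro power_mono) auto
    then have "M * r ^ 4 \<le> M * ((x - x0) \<bullet> (x - x0))\<^sup>2" using M by simp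
    moreover have "M * r ^ 4 = \<bar>B - c\<bar> + 1" using r by (simp add: M_def)
    ultimately show ?thesis using bd[of x] x by (simp add: \<psi>_def)
  qed
  moreover have "\<psi> x0 = u x0" by (simp add: \<psi>_def c_def)
  moreover have "\<forall>\<phi>. Ck_on 2 \<Omega> \<phi> \<and> u x0 = \<phi> x0 \<and> (\<forall>x\<in>\<Omega> - {x0}. u x < \<phi> x) \<longrightarrow>
        - inf_laplacian \<phi> x0 \<le> 0 \<or>
        norm (grad \<phi> x0) - lambda_1_inf \<Omega> * (\<phi> x0 powr l) \<le> 0"
    using u x0 unfolding viscosity_solution_def by blast
  ultimately have "- inf_laplacian \<psi> x0 \<le> 0 \<or> norm (grad \<psi> x0) - lambda_1_inf \<Omega> * (\<psi> x0 powr l) \<le> 0" using \<psi>(1) by metis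
  then show ?thesis unfolding \<psi>(2,3) using \<open>\<psi> x0 = u x0\<close> by simp
qed

lemma viscosity_touch_below:
  fixes u :: "'a::euclidean_space \<Rightarrow> real"
  assumes \<Omega>: "open \<Omega>" and u: "viscosity_solution \<Omega> l u" and x0: "x0 \<in> \<Omega>" and \<phi>: "Ck_on 2 \<Omega> \<phi>"
    and r: "r > 0" and loc: "\<And>x. x \<in> \<Omega> \<Longrightarrow> dist x x0 < r \<Longrightarrow> u x0 - \<phi> x0 \<le> u x - \<phi> x"
    and bd: "\<And>x. x \<in> \<Omega> \<Longrightarrow> \<phi> x \<le> u x + B"
  shows "inf_laplacian \<phi> x0 \<le> 0 \<and> norm (grad \<phi> x0) \<ge> lambda_1_inf \<Omega> * (u x0 powr l)"
proof -
  define c where "c = u x0 - \<phi> x0"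
  define M where "M = (\<bar>B + c\<bar> + 1) / r ^ 4"
  define \<psi> where "\<psi> x = \<phi> x + (c + (-M) * ((x - x0) \<bullet> (x - x0))\<^sup>2)" for x
  note \<psi> = C2_add_quartic[OF \<Omega> x0 \<phi>, of c "-M", folded \<psi>_def]
  have M: "M > 0" using r by (simp add: M_def)
  have "u x > \<psi> x" if x: "x \<in> \<Omega> - {x0}" for x
  proof (cases "dist x x0 < r")
    case True
    have "M * ((x - x0) \<bullet> (x - x0))\<^sup>2 > 0" using M x by simp
    then show ?thesis using loc[of x] True x by (simp add: \<psi>_def c_def)
  next
    case False
    then have "r\<^sup>2 \<le> (dist x x0)\<^sup>2" using r by (intro power_mono) auto
    then have "r\<^sup>2 \<le> (x - x0) \<bullet> (x - x0)" by (simp add: dist_norm power2_norm_eq_inner)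
    then have "(r\<^sup>2)\<^sup>2 \<le> ((x - x0) \<bullet> (x - x0))\<^sup>2" by (intro power_mono) auto
    then have "M * r ^ 4 \<le> M * ((x - x0) \<bullet> (x - x0))\<^sup>2" using M by simp
    moreover have "M * r ^ 4 = \<bar>B + c\<bar> + 1" using r by (simp add: M_def)
    ultimately show ?thesis using bd[of x] x by (simp add: \<psi>_def)
  qed
  moreover have "\<psi> x0 = u x0" by (simp add: \<psi>_def c_def)
  moreover have "\<forall>\<phi>. Ck_on 2 \<Omega> \<phi> \<and> u x0 = \<phi> x0 \<and> (\<forall>x\<in>\<Omega> - {x0}. u x > \<phi> x) \<longrightarrow>
        - inf_laplacian \<phi> x0 \<ge> 0 \<and>
        norm (grad \<phi> x0) - lambda_1_inf \<Omega> * (\<phi> x0 powr l) \<ge> 0"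
    using u x0 unfolding viscosity_solution_def by blast
  ultimately have "- inf_laplacian \<psi> x0 \<ge> 0 \<and> norm (grad \<psi> x0) - lambda_1_inf \<Omega> * (\<psi> x0 powr l) \<ge> 0" using \<psi>(1) by metis
  then show ?thesis unfolding \<psi>(2,3) using \<open>\<psi> x0 = u x0\<close> by simp
qed

text \<open>
  The right-hand side is the cubic Taylor polynomial of the square root at
  \<open>a\<^sup>2\<close>, evaluated at \<open>t\<^sup>2\<close>. The square root has negative
  fourth derivative, so it lies below this polynomial.
\<close>

lemma le_sqrt_taylor:
  fixes t a :: real
  assumes a: "a > 0"
  shows "t \<le> a + (t\<^sup>2 - a\<^sup>2) / (2*a) - (t\<^sup>2 - a\<^sup>2)\<^sup>2 / (8*a^3) + (t\<^sup>2 - a\<^sup>2)^3 / (16*a^5)"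
proof -
  define d where "d = t\<^sup>2 - a\<^sup>2"
  have "0 \<le> (t - a)^4 * ((t + 2*a)\<^sup>2 + a\<^sup>2)" by simp
  also have "\<dots> = 16*a^6 + 8*a^4 * d - 2*a^2 * d^2 + d^3 - 16*a^5 * t"
    unfolding d_def by (simp add: algebra_simps eval_nat_numeral)
  finally have "16*a^5 * t \<le> 16*a^6 + 8*a^4 * d - 2*a^2 * d^2 + d^3" by simp
  then have "t \<le> (16*a^6 + 8*a^4 * d - 2*a^2 * d^2 + d^3) / (16*a^5)"
    using a by (simp add: pos_le_divide_eq mult.commute)
  also have "\<dots> = 16*a^6 / (16*a^5) + 8*a^4 * d / (16*a^5) - 2*a^2 * d^2 / (16*a^5) + d^3 / (16*a^5)"
    by (simp add: add_divide_distrib diff_divide_distrib)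
  also have "16*a^6 / (16*a^5) = a" using a by (simp add: eval_nat_numeral)
  also have "8*a^4 * d / (16*a^5) = d / (2*a)" using a by (simp add: eval_nat_numeral)
  also have "2*a^2 * d^2 / (16*a^5) = d^2 / (8*a^3)" using a by (simp add: eval_nat_numeral)
  finally show ?thesis by (simp add: d_def)
qed

text \<open>
  A cone is not differentiable at its vertex and so is not itself an admissible test function.
  Replacing the square root in \<open>norm (x - z) = sqrt ((norm (x - z))\<^sup>2)\<close> by
  its cubic Taylor polynomial gives a polynomial above the bent cone with the same 2-jet at the
  contact point. The factor \<open>\<sigma>\<close> serves to use the function and its negative
  as tests.
\<close>

lemma perturbed_cone_test_function:
  fixes z x1 :: "'a::euclidean_space"
  assumes ne: "x1 \<noteq> z" and \<kappa>: "\<kappa> \<ge> 0"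
  defines "a \<equiv> norm (x1 - z)"
  obtains h where "\<And>x. \<kappa> * norm (x - z) - \<epsilon> * (norm (x - z))\<^sup>2 \<le> h x"
    "h x1 = \<kappa> * a - \<epsilon> * a\<^sup>2" "continuous_on UNIV h"
    "\<And>\<sigma> S. Ck_on 2 S (\<lambda>x. \<sigma> * h x)"
    "\<And>\<sigma>. norm (grad (\<lambda>x. \<sigma> * h x) x1) = \<bar>\<sigma>\<bar> * \<bar>\<kappa> - 2*\<epsilon>*a\<bar>"
    "\<And>\<sigma>. inf_laplacian (\<lambda>x. \<sigma> * h x) x1 = - (2 * \<epsilon> * \<sigma>^3 * (\<kappa> - 2*\<epsilon>*a)\<^sup>2)"
proof -
  have a: "a > 0" using ne by (simp add: a_def)
  define c1 c2 c3 where "c1 = \<kappa> / (2*a)" and "c2 = \<kappa> / (8*a^3)" and "c3 = \<kappa> / (16*a^5)"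
  define g where "g s = \<kappa> * a + c1 * (s - a\<^sup>2) - c2 * (s - a\<^sup>2)\<^sup>2 + c3 * (s - a\<^sup>2)^3 - \<epsilon> * s" for s
  define g' where "g' s = c1 - 2 * c2 * (s - a\<^sup>2) + 3 * c3 * (s - a\<^sup>2)\<^sup>2 - \<epsilon>" for s
  define g'' where "g'' s = 6 * c3 * (s - a\<^sup>2) - 2 * c2" for s
  define h where "h x = g ((x - z) \<bullet> (x - z))" for x
  have s1: "(x1 - z) \<bullet> (x1 - z) = a\<^sup>2" by (simp add: a_def power2_norm_eq_inner)
  have d1: "((\<lambda>s. \<sigma> * g s) has_real_derivative \<sigma> * g' s) (at s)" for s \<sigma>
    unfolding g_def g'_def by (auto intro!: derivative_eq_intros)
  have d2: "((\<lambda>s. \<sigma> * g' s) has_real_derivative \<sigma> * g'' s) (at s)" for s \<sigma>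
    unfolding g'_def g''_def by (auto intro!: derivative_eq_intros)
  have d3: "continuous_on UNIV (\<lambda>s. \<sigma> * g'' s)" for \<sigma>
    unfolding g''_def by (intro continuous_intros)
  note rad = C2_radial[OF d1 d2 d3, where z = z, folded h_def]
  define b where "b = \<kappa> - 2*\<epsilon>*a"
  have c1: "c1 = (b + 2*\<epsilon>*a) / (2*a)" and c2: "c2 = (b + 2*\<epsilon>*a) / (8*a^3)"
    by (simp_all add: c1_def c2_def b_def)
  have g1: "g' (a\<^sup>2) = b / (2*a)" using a by (simp add: g'_def c1 add_divide_distrib)
  have g2: "g'' (a\<^sup>2) = - (b + 2*\<epsilon>*a) / (4*a^3)"
    using a by (simp add: g''_def c2 field_simps)
  show thesis
  proof
    show "\<kappa> * norm (x - z) - \<epsilon> * (norm (x - z))\<^sup>2 \<le> h x" for x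
    proof -
      define d where "d = (norm (x - z))\<^sup>2 - a\<^sup>2"
      have "\<kappa> * norm (x - z) \<le> \<kappa> * (a + d / (2*a) - d\<^sup>2 / (8*a^3) + d^3 / (16*a^5))"
        unfolding d_def by (intro mult_left_mono le_sqrt_taylor a \<kappa>)
      also have "\<dots> = \<kappa> * a + c1 * d - c2 * d\<^sup>2 + c3 * d^3"
        by (simp add: c1_def c2_def c3_def ring_distribs)
      finally show ?thesis by (simp add: h_def g_def d_def power2_norm_eq_inner)
    qed
    show "h x1 = \<kappa> * a - \<epsilon> * a\<^sup>2" by (simp add: h_def s1 g_def)
    show "continuous_on UNIV h"
      unfolding h_def g_def by (intro continuous_intros)
    show "Ck_on 2 S (\<lambda>x. \<sigma> * h x)" for \<sigma> S by (rule rad(1))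
    show "norm (grad (\<lambda>x. \<sigma> * h x) x1) = \<bar>\<sigma>\<bar> * \<bar>\<kappa> - 2*\<epsilon>*a\<bar>" for \<sigma>
      using a by (simp add: rad(2) s1 g1 abs_mult flip: a_def b_def)
    show "inf_laplacian (\<lambda>x. \<sigma> * h x) x1 = - (2 * \<epsilon> * \<sigma>^3 * (\<kappa> - 2*\<epsilon>*a)\<^sup>2)" for \<sigma>
    proof -
      have "2 * (\<sigma> * g' (a\<^sup>2)) * a\<^sup>2 + 4 * (\<sigma> * g'' (a\<^sup>2)) * (a\<^sup>2)\<^sup>2
          = \<sigma> * (2 * g' (a\<^sup>2) * a\<^sup>2 + 4 * g'' (a\<^sup>2) * a^4)" by (simp add: algebra_simps)
      also have "2 * g' (a\<^sup>2) * a\<^sup>2 = b * a" unfolding g1 using a by (simp add: power2_eq_square)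
      also have "4 * g'' (a\<^sup>2) * a^4 = - (b + 2*\<epsilon>*a) * a"
      proof -
        have "a^4 = a^3 * a" by (simp add: eval_nat_numeral)
        then show ?thesis unfolding g2 using a by simp
      qed
      also have "\<sigma> * (b * a + - (b + 2*\<epsilon>*a) * a) = - 2 * \<epsilon> * \<sigma> * a\<^sup>2"
        by (simp add: algebra_simps power2_eq_square)
      finally have "inf_laplacian (\<lambda>x. \<sigma> * h x) x1 = (2 * (\<sigma> * g' (a\<^sup>2)))\<^sup>2 * (- 2 * \<epsilon> * \<sigma> * a\<^sup>2)"
        unfolding rad(3) s1 Let_def by simp
      also have "2 * (\<sigma> * g' (a\<^sup>2)) = \<sigma> * b / a" using a by (simp add: g1)
      also have "(\<sigma> * b / a)\<^sup>2 * (- 2 * \<epsilon> * \<sigma> * a\<^sup>2) = - (2 * \<epsilon> * \<sigma>^3 * b\<^sup>2)"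
        using a by (simp add: power_divide power_mult_distrib eval_nat_numeral)
      finally show ?thesis by (simp add: b_def)
    qed
  qed
qed

lemma continuous_imp_bounded_on_bounded:
  fixes h :: "'a::euclidean_space \<Rightarrow> real"
  assumes "bounded \<Omega>" "continuous_on UNIV h"
  obtains B where "\<And>x. x \<in> \<Omega> \<Longrightarrow> \<bar>h x\<bar> \<le> B"
proof -
  have "continuous_on (closure \<Omega>) h" using assms(2) continuous_on_subset by blast
  then have "compact (h ` closure \<Omega>)"
    using assms(1) by (intro compact_continuous_image) simp_all
  then have "bounded (h ` closure \<Omega>)" by (rule compact_imp_bounded)
  then obtain B where "\<And>x. x \<in> closure \<Omega> \<Longrightarrow> \<bar>h x\<bar> \<le> B" unfolding bounded_iff by auto
  then show thesis using that[of B] closure_subset[of \<Omega>] by blast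
qed

text \<open>
  If \<open>u\<close> rose above the cone, it would touch a slightly bent cone from below at a
  point where the disjunct on the right of \<open>edge\<close> holds. The bent cone has slope
  above \<open>K\<close> and strictly negative second radial derivative, which violates both
  alternatives for a subsolution.
\<close>

lemma subsolution_below_cone:
  fixes u :: "'a::euclidean_space \<Rightarrow> real"
  assumes \<Omega>: "open \<Omega>" "bounded \<Omega>" and u: "viscosity_solution \<Omega> l u"
    and bd: "\<And>x. x \<in> \<Omega> \<Longrightarrow> u x \<le> B" and D: "compact D" "continuous_on D u" and K: "K \<ge> 0"
    and edge: "\<And>y. y \<in> D \<Longrightarrow> u y \<le> A + K * norm (y - z) \<or>
      (y \<noteq> z \<and> y \<in> interior D \<and> y \<in> \<Omega> \<and> lambda_1_inf \<Omega> * (u y powr l) \<le> K)"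
    and y: "y \<in> D"
  shows "u y \<le> A + K * norm (y - z)"
proof (rule ccontr)
  assume neg: "\<not> u y \<le> A + K * norm (y - z)"
  obtain \<rho> where \<rho>: "\<rho> > 0" "\<And>x. x \<in> D \<Longrightarrow> norm (x - z) \<le> \<rho>"
  proof -
    have "bounded ((\<lambda>x. x - z) ` D)" using D(1) compact_imp_bounded bounded_translation_minus by blast
    then show thesis using that unfolding bounded_pos by auto
  qed
  define \<eta> where "\<eta> = u y - (A + K * norm (y - z))"
  \<comment> \<open>The radial profile \<open>\<kappa> t - \<epsilon> t\<^sup>2\<close> has slope above \<open>K\<close> for all \<open>t \<le> \<rho>\<close> and exceeds \<open>K t\<close>
    by at most \<open>3 \<epsilon> \<rho>\<^sup>2 = \<eta> / 2\<close>.\<close>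
  define \<epsilon> where "\<epsilon> = \<eta> / (6 * \<rho>\<^sup>2)"
  define \<kappa> where "\<kappa> = K + 3 * \<epsilon> * \<rho>"
  have \<eta>: "\<eta> > 0" using neg by (simp add: \<eta>_def)
  have \<epsilon>: "\<epsilon> > 0" using \<eta> \<rho>(1) by (simp add: \<epsilon>_def)
  have \<kappa>: "\<kappa> \<ge> 0" using K \<epsilon> \<rho>(1) by (simp add: \<kappa>_def)
  define F where "F x = u x - (A + (\<kappa> * norm (x - z) - \<epsilon> * (norm (x - z))\<^sup>2))" for x
  have "continuous_on D F" unfolding F_def by (intro continuous_intros D(2))
  then obtain x1 where x1: "x1 \<in> D" "\<And>x. x \<in> D \<Longrightarrow> F x \<le> F x1"
    using continuous_attains_sup[OF D(1)] y by blast
  have "3 * \<epsilon> * \<rho> * norm (y - z) \<le> 3 * \<epsilon> * \<rho> * \<rho>" using \<rho> y \<epsilon> by (intro mult_left_mono) auto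
  also have "\<dots> = \<eta> / 2" using \<rho>(1) by (simp add: \<epsilon>_def power2_eq_square)
  finally have "3 * \<epsilon> * \<rho> * norm (y - z) \<le> \<eta> / 2" .
  moreover have "F y = \<eta> - 3 * \<epsilon> * \<rho> * norm (y - z) + \<epsilon> * (norm (y - z))\<^sup>2"
    by (simp add: F_def \<eta>_def \<kappa>_def algebra_simps)
  moreover have "\<epsilon> * (norm (y - z))\<^sup>2 \<ge> 0" using \<epsilon> by simp
  ultimately have "\<eta> / 2 \<le> F y" by linarith
  then have F1: "F x1 > 0" using x1(2)[OF y] \<eta> by linarith
  have "\<epsilon> * norm (x1 - z) * norm (x1 - z) \<le> \<epsilon> * \<rho> * norm (x1 - z)"
    using \<rho>(2)[OF x1(1)] \<epsilon> by (intro mult_right_mono mult_left_mono) auto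
  also have "\<dots> \<le> 3 * \<epsilon> * \<rho> * norm (x1 - z)" using \<rho>(1) \<epsilon> by simp
  finally have "A + K * norm (x1 - z) < u x1"
    using F1 by (simp add: F_def \<kappa>_def power2_eq_square algebra_simps)
  with edge[OF x1(1)] have x1': "x1 \<noteq> z" "x1 \<in> interior D" "x1 \<in> \<Omega>" "lambda_1_inf \<Omega> * (u x1 powr l) \<le> K"
    by auto
  define a where "a = norm (x1 - z)"
  obtain h where h: "\<And>x. \<kappa> * norm (x - z) - \<epsilon> * (norm (x - z))\<^sup>2 \<le> h x"
    "h x1 = \<kappa> * a - \<epsilon> * a\<^sup>2" "continuous_on UNIV h"
    "\<And>\<sigma> S. Ck_on 2 S (\<lambda>x. \<sigma> * h x)"
    "\<And>\<sigma>. norm (grad (\<lambda>x. \<sigma> * h x) x1) = \<bar>\<sigma>\<bar> * \<bar>\<kappa> - 2*\<epsilon>*a\<bar>"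
    "\<And>\<sigma>. inf_laplacian (\<lambda>x. \<sigma> * h x) x1 = - (2 * \<epsilon> * \<sigma>^3 * (\<kappa> - 2*\<epsilon>*a)\<^sup>2)"
    using perturbed_cone_test_function[OF x1'(1) \<kappa>, of \<epsilon>, folded a_def] by blast
  obtain r where r: "r > 0" "ball x1 r \<subseteq> D" using x1'(2) by (auto simp: mem_interior)
  obtain B' where B': "\<And>x. x \<in> \<Omega> \<Longrightarrow> \<bar>h x\<bar> \<le> B'"
    using continuous_imp_bounded_on_bounded[OF \<Omega>(2) h(3)] by blast
  have "inf_laplacian h x1 \<ge> 0 \<or> norm (grad h x1) \<le> lambda_1_inf \<Omega> * (u x1 powr l)"
  proof (rule viscosity_touch_above[OF \<Omega>(1) u x1'(3) h(4)[where \<sigma> = 1, simplified] r(1), where B = "B + B'"])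
    fix x assume x: "x \<in> \<Omega>" "dist x x1 < r"
    then have "F x \<le> F x1" using r(2) x1(2) by (auto simp: subset_iff dist_commute)
    then show "u x - h x \<le> u x1 - h x1" using h(1)[of x] by (simp add: h(2) F_def flip: a_def)
  next
    fix x assume x: "x \<in> \<Omega>"
    then show "u x \<le> h x + (B + B')" using B'[of x] bd[of x] by linarith
  qed
  moreover have "\<epsilon> * a \<le> \<epsilon> * \<rho>" using \<rho>(2)[OF x1(1)] \<epsilon> by (simp add: a_def)
  then have "\<kappa> - 2*\<epsilon>*a > K" using mult_pos_pos[OF \<epsilon> \<rho>(1)] unfolding \<kappa>_def by linarith
  moreover have "(\<kappa> - 2*\<epsilon>*a)\<^sup>2 > 0" using calculation(2) K by simp
  then have "2 * \<epsilon> * (\<kappa> - 2*\<epsilon>*a)\<^sup>2 > 0" using \<epsilon> by simp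
  ultimately show False using h(5)[of 1] h(6)[of 1] x1'(4) K by simp
qed

text \<open>
  The mirror image of comparison from above. A supersolution is infinity-superharmonic
  everywhere, also where its gradient is small, so every slope \<open>K \<ge> 0\<close> is
  admissible.
\<close>

lemma supersolution_above_cone:
  fixes u :: "'a::euclidean_space \<Rightarrow> real"
  assumes \<Omega>: "open \<Omega>" "bounded \<Omega>" and u: "viscosity_solution \<Omega> l u"
    and D: "compact D" "continuous_on D u" and K: "K \<ge> 0"
    and edge: "\<And>y. y \<in> D \<Longrightarrow> u y \<ge> A - K * norm (y - z) \<or>
      (y \<noteq> z \<and> y \<in> interior D \<and> y \<in> \<Omega>)"
    and y: "y \<in> D"
  shows "u y \<ge> A - K * norm (y - z)"
proof (rule ccontr)
  assume neg: "\<not> u y \<ge> A - K * norm (y - z)"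
  obtain \<rho> where \<rho>: "\<rho> > 0" "\<And>x. x \<in> D \<Longrightarrow> norm (x - z) \<le> \<rho>"
  proof -
    have "bounded ((\<lambda>x. x - z) ` D)" using D(1) compact_imp_bounded bounded_translation_minus by blast
    then show thesis using that unfolding bounded_pos by auto
  qed
  define \<eta> where "\<eta> = (A - K * norm (y - z)) - u y"
  \<comment> \<open>The radial profile \<open>\<kappa> t - \<epsilon> t\<^sup>2\<close> has slope above \<open>K\<close> for all \<open>t \<le> \<rho>\<close> and exceeds \<open>K t\<close>
    by at most \<open>3 \<epsilon> \<rho>\<^sup>2 = \<eta> / 2\<close>.\<close>
  define \<epsilon> where "\<epsilon> = \<eta> / (6 * \<rho>\<^sup>2)"
  define \<kappa> where "\<kappa> = K + 3 * \<epsilon> * \<rho>"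
  have \<eta>: "\<eta> > 0" using neg by (simp add: \<eta>_def)
  have \<epsilon>: "\<epsilon> > 0" using \<eta> \<rho>(1) by (simp add: \<epsilon>_def)
  have \<kappa>: "\<kappa> \<ge> 0" using K \<epsilon> \<rho>(1) by (simp add: \<kappa>_def)
  define F where "F x = u x - (A - (\<kappa> * norm (x - z) - \<epsilon> * (norm (x - z))\<^sup>2))" for x
  have "continuous_on D F" unfolding F_def by (intro continuous_intros D(2))
  then obtain x1 where x1: "x1 \<in> D" "\<And>x. x \<in> D \<Longrightarrow> F x1 \<le> F x"
    using continuous_attains_inf[OF D(1)] y by blast
  have "3 * \<epsilon> * \<rho> * norm (y - z) \<le> 3 * \<epsilon> * \<rho> * \<rho>" using \<rho> y \<epsilon> by (intro mult_left_mono) auto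
  also have "\<dots> = \<eta> / 2" using \<rho>(1) by (simp add: \<epsilon>_def power2_eq_square)
  finally have "3 * \<epsilon> * \<rho> * norm (y - z) \<le> \<eta> / 2" .
  moreover have "F y = 3 * \<epsilon> * \<rho> * norm (y - z) - \<epsilon> * (norm (y - z))\<^sup>2 - \<eta>"
    by (simp add: F_def \<eta>_def \<kappa>_def algebra_simps)
  moreover have "\<epsilon> * (norm (y - z))\<^sup>2 \<ge> 0" using \<epsilon> by simp
  ultimately have "F y \<le> - \<eta> / 2" by linarith
  then have F1: "F x1 < 0" using x1(2)[OF y] \<eta> by linarith
  have "\<epsilon> * norm (x1 - z) * norm (x1 - z) \<le> \<epsilon> * \<rho> * norm (x1 - z)"
    using \<rho>(2)[OF x1(1)] \<epsilon> by (intro mult_right_mono mult_left_mono) auto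
  also have "\<dots> \<le> 3 * \<epsilon> * \<rho> * norm (x1 - z)" using \<rho>(1) \<epsilon> by simp
  finally have "A - K * norm (x1 - z) > u x1"
    using F1 by (simp add: F_def \<kappa>_def power2_eq_square algebra_simps)
  with edge[OF x1(1)] have x1': "x1 \<noteq> z" "x1 \<in> interior D" "x1 \<in> \<Omega>"
    by auto
  define a where "a = norm (x1 - z)"
  obtain h where h: "\<And>x. \<kappa> * norm (x - z) - \<epsilon> * (norm (x - z))\<^sup>2 \<le> h x"
    "h x1 = \<kappa> * a - \<epsilon> * a\<^sup>2" "continuous_on UNIV h"
    "\<And>\<sigma> S. Ck_on 2 S (\<lambda>x. \<sigma> * h x)"
    "\<And>\<sigma>. norm (grad (\<lambda>x. \<sigma> * h x) x1) = \<bar>\<sigma>\<bar> * \<bar>\<kappa> - 2*\<epsilon>*a\<bar>"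
    "\<And>\<sigma>. inf_laplacian (\<lambda>x. \<sigma> * h x) x1 = - (2 * \<epsilon> * \<sigma>^3 * (\<kappa> - 2*\<epsilon>*a)\<^sup>2)"
    using perturbed_cone_test_function[OF x1'(1) \<kappa>, of \<epsilon>, folded a_def] by blast
  obtain r where r: "r > 0" "ball x1 r \<subseteq> D" using x1'(2) by (auto simp: mem_interior)
  obtain B' where B': "\<And>x. x \<in> \<Omega> \<Longrightarrow> \<bar>h x\<bar> \<le> B'"
    using continuous_imp_bounded_on_bounded[OF \<Omega>(2) h(3)] by blast
  have "inf_laplacian (\<lambda>x. (-1) * h x) x1 \<le> 0 \<and> norm (grad (\<lambda>x. (-1) * h x) x1) \<ge> lambda_1_inf \<Omega> * (u x1 powr l)"
  proof (rule viscosity_touch_below[OF \<Omega>(1) u x1'(3) h(4) r(1), where B = "B'"])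
    fix x assume x: "x \<in> \<Omega>" "dist x x1 < r"
    then have "F x1 \<le> F x" using r(2) x1(2) by (auto simp: subset_iff dist_commute)
    then show "u x1 - (-1) * h x1 \<le> u x - (-1) * h x"
      using h(1)[of x] by (simp add: h(2) F_def flip: a_def)
  next
    fix x assume x: "x \<in> \<Omega>"
    then have "u x \<ge> 0" using u by (simp add: viscosity_solution_def)
    then show "(-1) * h x \<le> u x + B'" using B'[of x] x by linarith
  qed
  moreover have "\<epsilon> * a \<le> \<epsilon> * \<rho>" using \<rho>(2)[OF x1(1)] \<epsilon> by (simp add: a_def)
  then have "\<kappa> - 2*\<epsilon>*a > K" using mult_pos_pos[OF \<epsilon> \<rho>(1)] unfolding \<kappa>_def by linarith
  then have "(\<kappa> - 2*\<epsilon>*a)\<^sup>2 > 0" using K by simp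
  ultimately show False using h(6)[of "-1"] \<epsilon> by (simp add: mult_pos_pos mult_le_0_iff)
qed

text \<open>
  A smoothed cone of slope less than \<open>\<Lambda> R\<^sup>l\<close> has too small a gradient
  to touch \<open>u\<close> from below inside the ball, so the minimum of \<open>u\<close> plus
  that cone sits on the sphere. Smoothing at the vertex is essential, since contact at the
  vertex of a true cone would give no information.
\<close>

lemma supersolution_decay:
  fixes u :: "'a::euclidean_space \<Rightarrow> real"
  assumes \<Omega>: "open \<Omega>" "bounded \<Omega>" and u: "viscosity_solution \<Omega> l u"
    and r: "r > 0" and sub: "cball z r \<subseteq> \<Omega>" and R: "R \<ge> 0" "\<And>y. y \<in> cball z r \<Longrightarrow> R \<le> u y"
    and l: "l \<ge> 0"
  obtains y where "y \<in> cball z r" "u y \<le> u z - r * (lambda_1_inf \<Omega> * (R powr l))"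
proof (rule ccontr)
  define \<beta> where "\<beta> = lambda_1_inf \<Omega> * (R powr l)"
  assume "\<not> thesis"
  with that have neg: "\<And>y. y \<in> cball z r \<Longrightarrow> u z - r * \<beta> < u y" by (force simp: \<beta>_def)
  from neg[of z] r have \<beta>: "\<beta> > 0" by (simp add: zero_less_mult_iff)
  have cont: "continuous_on (cball z r) u"
    using u sub continuous_on_subset by (auto simp: viscosity_solution_def)
  obtain y0 where y0: "y0 \<in> cball z r" "\<And>y. y \<in> cball z r \<Longrightarrow> u y0 \<le> u y"
    using continuous_attains_inf[OF compact_cball _ cont] r by auto
  define \<gamma> where "\<gamma> = r * \<beta> - (u z - u y0)"
  have \<gamma>: "\<gamma> > 0" "\<gamma> \<le> r * \<beta>" using neg[OF y0(1)] y0(2)[of z] r by (auto simp: \<gamma>_def)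
  \<comment> \<open>A slope \<open>b < \<beta>\<close> and a smoothing width \<open>\<delta>\<close> that each use up only a quarter of the gap \<open>\<gamma>\<close>.\<close>
  define b where "b = \<beta> - \<gamma> / (4 * r)"
  define \<delta> where "\<delta> = \<gamma> / (4 * \<beta>)"
  have b: "0 < b" "b < \<beta>"
    using \<gamma> r \<beta> mult_pos_pos[OF r \<beta>] by (auto simp: b_def field_simps)
  have \<delta>: "\<delta> > 0" using \<gamma> \<beta> by (simp add: \<delta>_def)
  have "b * \<delta> \<le> \<beta> * \<delta>" using b \<delta> by simp
  moreover have "\<beta> * \<delta> = \<gamma> / 4" "b * r = \<beta> * r - \<gamma> / 4" using \<beta> r by (auto simp: \<delta>_def b_def field_simps)
  ultimately have gap: "u z + b * \<delta> < u y0 + b * r"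
    using \<gamma>(1) \<gamma>_def mult.commute[of r \<beta>] by linarith
  define q where "q y = sqrt ((y - z) \<bullet> (y - z) + \<delta>\<^sup>2)" for y
  define F where "F y = u y + b * q y" for y
  have "continuous_on (cball z r) F" unfolding F_def q_def by (intro continuous_intros cont)
  then obtain y1 where y1: "y1 \<in> cball z r" "\<And>y. y \<in> cball z r \<Longrightarrow> F y1 \<le> F y"
    using continuous_attains_inf[OF compact_cball, of z r F] r by auto
  have q2: "(q y)\<^sup>2 = (y - z) \<bullet> (y - z) + \<delta>\<^sup>2" for y by (simp add: q_def)
  have qpos: "q y > 0" for y unfolding q_def using \<delta> by (simp add: add_nonneg_pos)
  have qn: "norm (y - z) < q y" for y
    unfolding q_def using \<delta> by (simp add: real_less_rsqrt power2_norm_eq_inner)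
  have "q z = \<delta>" using \<delta> by (simp add: q_def)
  then have "F y1 \<le> u z + b * \<delta>" using y1(2)[of z] r by (simp add: F_def)
  then have "u y1 + b * q y1 < u y0 + b * r" using gap by (simp add: F_def)
  with y0(2)[OF y1(1)] have "b * q y1 < b * r" by linarith
  then have "norm (y1 - z) < r" using b qn[of y1] by simp
  then have "y1 \<in> ball z r" by (simp add: dist_norm norm_minus_commute)
  then obtain \<rho> where \<rho>: "\<rho> > 0" "ball y1 \<rho> \<subseteq> ball z r"
    using openE[OF open_ball] by blast
  define k where "k = - b / (2 * q y1)"
  define h where "h x = k * ((x - z) \<bullet> (x - z))" for x
  have d1: "((\<lambda>s. k * s) has_real_derivative k) (at s)" for s
    by (auto intro!: derivative_eq_intros)
  have h2: "Ck_on 2 \<Omega> h" "grad h y1 = (2 * k) *\<^sub>R (y1 - z)"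
    using C2_radial[OF d1 DERIV_const continuous_on_const, where z = z, folded h_def] by auto
  have hb: "h x \<le> u x + 0" if "x \<in> \<Omega>" for x
  proof -
    have "u x \<ge> 0" using u that by (simp add: viscosity_solution_def)
    moreover have "h x \<le> 0" using b qpos[of y1] by (simp add: h_def k_def)
    ultimately show ?thesis by simp
  qed
  have "norm (grad h y1) \<ge> lambda_1_inf \<Omega> * (u y1 powr l)"
  proof (rule conjunct2[OF viscosity_touch_below[OF \<Omega>(1) u _ h2(1) \<rho>(1) _ hb]])
    show "y1 \<in> \<Omega>" using y1 sub by auto
    fix x assume x: "x \<in> \<Omega>" "dist x y1 < \<rho>"
    then have "x \<in> cball z r" using \<rho>(2) ball_subset_cball by (metis dist_commute in_mono mem_ball)
    then have F: "F y1 \<le> F x" by (rule y1)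
    \<comment> \<open>Concavity of the square root: \<open>q\<close> lies below its tangent in the squared distance.\<close>
    have "0 \<le> (q x - q y1)\<^sup>2" by simp
    then have "2 * q y1 * (q x - q y1) \<le> (q x)\<^sup>2 - (q y1)\<^sup>2"
      by (simp add: power2_eq_square algebra_simps)
    then have "q x - q y1 \<le> ((q x)\<^sup>2 - (q y1)\<^sup>2) / (2 * q y1)"
      using qpos[of y1] by (simp add: field_simps)
    then have "b * (q x - q y1) \<le> b * (((q x)\<^sup>2 - (q y1)\<^sup>2) / (2 * q y1))"
      using b by (intro mult_left_mono) auto
    also have "\<dots> = h y1 - h x" by (simp add: q2 h_def k_def diff_divide_distrib right_diff_distrib)
    finally show "u y1 - h y1 \<le> u x - h x" using F by (simp add: F_def right_diff_distrib)
  qed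
  moreover have "norm (grad h y1) = b * (norm (y1 - z) / q y1)"
    using b qpos[of y1] by (simp add: h2 k_def)
  moreover have "b * (norm (y1 - z) / q y1) \<le> b * 1" using b qpos[of y1] qn[of y1]
    by (intro mult_left_mono) (auto simp: field_simps)
  moreover have "\<beta> \<le> lambda_1_inf \<Omega> * (u y1 powr l)"
    unfolding \<beta>_def using \<beta> R y1 l
    by (intro mult_left_mono powr_mono2) (auto simp: \<beta>_def zero_less_mult_iff)
  ultimately show False using b by linarith
qed

section \<open>The comparison principle for exponents below one\<close>

text \<open>
  \<open>T\<close> is strictly concave with slope \<open>(T t / t) powr (1 - a)\<close>, because
  \<open>T t / t = (M * t powr (-a) + 1) powr (1 / a)\<close> is strictly decreasing. It
  transports a value \<open>t\<close> of the supersolution to the value \<open>s\<close> with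
  \<open>s powr a - t powr a = M\<close>.
\<close>

lemma power_sum_secant_bounds:
  fixes M a s t :: real
  assumes M: "M > 0" and a: "0 < a" "a < 1" and st: "0 < s" "s < t"
  defines "T \<equiv> \<lambda>t. (M + t powr a) powr (1 / a)"
  shows "T t - T s < (t - s) * (T s / s) powr (1 - a)"
    and "(t - s) * (T t / t) powr (1 - a) < T t - T s"
proof -
  define T' where "T' x = (T x / x) powr (1 - a)" for x
  have quot: "T x / x = (M * x powr (- a) + 1) powr (1 / a)" if "x > 0" for x
  proof -
    have "x = (x powr a) powr (1 / a)" using that a by (simp add: powr_powr)
    then have "T x / x = ((M + x powr a) / x powr a) powr (1 / a)"
      using that M by (simp add: T_def powr_divide)
    also have "(M + x powr a) / x powr a = M * x powr (- a) + 1"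
      using that by (simp add: powr_minus field_simps)
    finally show ?thesis .
  qed
  have anti: "T' y < T' x" if "0 < x" "x < y" for x y
  proof -
    have "y powr (- a) < x powr (- a)" using that a by (intro powr_less_mono2_neg) auto
    then have "M * y powr (- a) + 1 < M * x powr (- a) + 1" using M by simp
    then have "T y / y < T x / x"
      using that a M by (simp add: quot powr_less_mono2 add_nonneg_pos)
    moreover have "0 \<le> T y / y" using that by (simp add: T_def)
    ultimately show ?thesis unfolding T'_def using a by (intro powr_less_mono2) auto
  qed
  have der: "(T has_real_derivative T' x) (at x)" if "x > 0" for x
  proof -
    have pos: "M + x powr a > 0" using M by (simp add: add_pos_nonneg)
    have "((\<lambda>t. M + t powr a) has_real_derivative a * x powr (a - 1)) (at x)"
      using DERIV_add[OF DERIV_const has_real_derivative_powr[OF that]] by simp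
    from DERIV_chain2[OF has_real_derivative_powr[OF pos] this]
    have "(T has_real_derivative (1 / a) * (M + x powr a) powr (1 / a - 1) * (a * x powr (a - 1))) (at x)"
      unfolding T_def .
    moreover have "(1 / a) * (M + x powr a) powr (1 / a - 1) * (a * x powr (a - 1)) = T' x"
    proof -
      have "(1 / a) * (1 - a) = 1 / a - 1" using a by (simp add: field_simps)
      then have "T' x = (M + x powr a) powr (1 / a - 1) / x powr (1 - a)"
        using that pos by (simp add: T'_def T_def powr_divide powr_powr)
      also have "\<dots> = (M + x powr a) powr (1 / a - 1) * x powr (a - 1)"
        using that powr_minus[of x "1 - a"] by (simp add: divide_inverse)
      finally show ?thesis using a by simp
    qed
    ultimately show ?thesis by simp
  qed
  obtain x where x: "s < x" "x < t" "T t - T s = (t - s) * T' x"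
    using MVT2[of s t T T'] der st by force
  have "T' x < T' s" "T' t < T' x" using x st by (auto intro: anti)
  then show "T t - T s < (t - s) * (T s / s) powr (1 - a)"
    "(t - s) * (T t / t) powr (1 - a) < T t - T s"
    using x(3) st unfolding T'_def[symmetric] by auto
qed

lemma compact_neighbourhood:
  fixes K :: "'a::euclidean_space set"
  assumes "compact K" "open U" "K \<subseteq> U"
  shows "\<exists>\<rho>>0. \<exists>K'. compact K' \<and> K' \<subseteq> U \<and> (\<forall>x\<in>K. cball x \<rho> \<subseteq> K')"
proof -
  obtain \<rho> where \<rho>: "\<rho> > 0" "(\<Union>x\<in>K. cball x \<rho>) \<subseteq> U"
    using compact_subset_open_imp_cball_epsilon_subset[OF assms] by blast
  have eq: "{x + y | x y. x \<in> K \<and> y \<in> cball 0 \<rho>} = (\<Union>x\<in>K. cball x \<rho>)"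
  proof (intro equalityI subsetI)
    fix v assume "v \<in> {x + y | x y. x \<in> K \<and> y \<in> cball 0 \<rho>}"
    then obtain x y where "x \<in> K" "norm y \<le> \<rho>" "v = x + y" by auto
    then have "x \<in> K" "v \<in> cball x \<rho>" by (simp_all add: dist_norm)
    then show "v \<in> (\<Union>x\<in>K. cball x \<rho>)" by blast
  next
    fix v assume "v \<in> (\<Union>x\<in>K. cball x \<rho>)"
    then obtain x where "x \<in> K" "norm (v - x) \<le> \<rho>" by (auto simp: dist_norm norm_minus_commute)
    then have "v = x + (v - x) \<and> x \<in> K \<and> v - x \<in> cball 0 \<rho>" by simp
    then show "v \<in> {x + y | x y. x \<in> K \<and> y \<in> cball 0 \<rho>}" by blast
  qed
  have "compact (\<Union>x\<in>K. cball x \<rho>)"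
    unfolding eq[symmetric] by (intro compact_sums assms compact_cball)
  with \<rho> show ?thesis by blast
qed

lemma mem_closure_cases: "open S \<Longrightarrow> x \<in> closure S \<Longrightarrow> x \<in> S \<or> x \<in> frontier S"
  by (auto simp: frontier_def interior_open)

text \<open>
  Suppose \<open>u > w\<close> somewhere and scale \<open>w\<close> by some \<open>c > 1\<close>
  without destroying this. Put \<open>a = 1 - l\<close> and let \<open>(y0, z0)\<close> maximise
  \<open>u y powr a - (c * w z) powr a\<close> over pairs at distance at most \<open>2 *
  r\<close>, with maximum \<open>M > 0\<close> and midpoint \<open>x0\<close>. With \<open>A, B,
  C\<close> the values of \<open>u\<close> at \<open>x0\<close>, at \<open>y0\<close> and its
  maximum over the ball of radius \<open>2 * r\<close>, and \<open>P, Q, R\<close> the values of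
  \<open>w\<close> at \<open>x0\<close>, at \<open>z0\<close> and its minimum over that ball,
  maximality says \<open>A \<le> T (c * R)\<close>, \<open>B = T (c * Q)\<close> and \<open>C
  \<le> T (c * P)\<close> for the strictly concave \<open>T t = (M + t powr a) powr (1 /
  a)\<close>. Cones centred at \<open>x0\<close> give \<open>P - Q \<le> Q - R\<close>, and
  \<open>Q - R > 0\<close> by decay. The cone above \<open>u\<close> with vertex over
  \<open>x0\<close> has the larger of the slopes \<open>(C - A) / (2 * r)\<close> and
  \<open>\<Lambda> * C powr l\<close>. In the first case \<open>2 * B \<le> A + C\<close>,
  contradicting strict concavity. In the second \<open>B - A \<le> r * \<Lambda> * C powr
  l\<close>, whereas decay and the slope of \<open>T\<close> give essentially \<open>B - A \<ge>
  c powr a * r * \<Lambda> * B powr l\<close>; since \<open>c > 1\<close>, this is impossible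
  for small \<open>r\<close>.
\<close>

lemma comparison:
  fixes u w :: "'a::euclidean_space \<Rightarrow> real"
  assumes \<Omega>: "open \<Omega>" "bounded \<Omega>" and \<Lambda>: "lambda_1_inf \<Omega> > 0"
    and u: "dirichlet_solution \<Omega> m u" "\<And>x. x \<in> \<Omega> \<Longrightarrow> u x \<le> 1"
    and w: "dirichlet_solution \<Omega> l w" "\<And>x. x \<in> \<Omega> \<Longrightarrow> 0 < w x"
    and l: "0 < l" "l < 1" "l \<le> m"
    and x: "x \<in> closure \<Omega>"
  shows "u x \<le> w x"
proof (rule ccontr)
  assume neg: "\<not> u x \<le> w x"
  define \<Lambda> where "\<Lambda> = lambda_1_inf \<Omega>"
  define a where "a = 1 - l"
  have a: "0 < a" "a < 1" using l by (auto simp: a_def)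
  have vu: "viscosity_solution \<Omega> m u" "continuous_on (closure \<Omega>) u"
    "\<And>y. y \<in> frontier \<Omega> \<Longrightarrow> u y = 0" "\<And>y. y \<in> \<Omega> \<Longrightarrow> 0 \<le> u y"
    using u by (auto simp: dirichlet_solution_def viscosity_solution_def)
  have vw: "viscosity_solution \<Omega> l w" "continuous_on (closure \<Omega>) w"
    "\<And>y. y \<in> frontier \<Omega> \<Longrightarrow> w y = 0"
    using w by (auto simp: dirichlet_solution_def)
  have comp: "compact (closure \<Omega>)" using \<Omega>(2) by simp
  have unn: "0 \<le> u y" and wnn: "0 \<le> w y" if "y \<in> closure \<Omega>" for y
    using mem_closure_cases[OF \<Omega>(1) that] vu(3,4) vw(3) w(2) by force+
  have x\<Omega>: "x \<in> \<Omega>" using mem_closure_cases[OF \<Omega>(1) x] vu(3) vw(3) neg by fastforce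
  \<comment> \<open>Halfway between \<open>1\<close> and the ratio of the values at \<open>x\<close>, so that \<open>c * w x\<close> is still below \<open>u x\<close>.\<close>
  define c where "c = (1 + u x / w x) / 2"
  have c: "c > 1" "c * w x < u x" using neg w(2)[OF x\<Omega>] by (auto simp: c_def field_simps)
  define M0 where "M0 = u x powr a - (c * w x) powr a"
  have M0: "M0 > 0" using c a w(2)[OF x\<Omega>] by (simp add: M0_def powr_less_mono2)
  define \<beta> where "\<beta> = M0 powr (1 / a)"
  have \<beta>: "\<beta> > 0" using M0 by (simp add: \<beta>_def)
  \<comment> \<open>Whatever \<open>r\<close> is, an optimal pair has \<open>u y0 \<ge> \<beta>\<close>, so it stays in a compact part of the domain,
    where \<open>w\<close> is bounded below.\<close>
  define K where "K = closure \<Omega> \<inter> u -` {\<beta>..}"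
  have "closed K" unfolding K_def by (intro continuous_closed_preimage vu(2)) auto
  then have "compact (K \<inter> closure \<Omega>)" using comp by (rule closed_Int_compact)
  moreover have "K \<inter> closure \<Omega> = K" by (auto simp: K_def)
  ultimately have K1: "compact K" by simp
  have K2: "K \<subseteq> \<Omega>" using mem_closure_cases[OF \<Omega>(1)] vu(3) \<beta> by (force simp: K_def)
  obtain \<rho> K' where \<rho>: "\<rho> > 0" "compact K'" "K' \<subseteq> \<Omega>" "\<forall>y\<in>K. cball y \<rho> \<subseteq> K'"
    using compact_neighbourhood[OF K1 \<Omega>(1) K2] by blast
  obtain \<mu> where \<mu>: "\<mu> > 0" "\<And>y. y \<in> K' \<Longrightarrow> \<mu> \<le> w y"
  proof (cases "K' = {}")
    case False
    have "K' \<subseteq> closure \<Omega>" using \<rho>(3) closure_subset by (rule order_trans)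
    with vw(2) have "continuous_on K' w" by (rule continuous_on_subset)
    then obtain y where "y \<in> K'" "\<And>v. v \<in> K' \<Longrightarrow> w y \<le> w v"
      using continuous_attains_inf[OF \<rho>(2) False] by blast
    then show thesis using that w(2) \<rho>(3) by blast
  qed (use that[of 1] in auto)
  \<comment> \<open>With this \<open>\<gamma>\<close>, the bounds \<open>C < sqrt \<gamma> * B\<close> and \<open>Q < sqrt \<gamma> * R\<close> suffice in the gradient case
    below; they hold once the oscillations at scale \<open>3 * r\<close> are below \<open>\<eta>\<close>.\<close>
  define \<gamma> where "\<gamma> = c powr (a / l)"
  have \<gamma>: "\<gamma> > 1" "\<gamma> powr l = c powr a" using c(1) a l by (auto simp: \<gamma>_def powr_powr)
  define \<eta> where "\<eta> = (sqrt \<gamma> - 1) * min \<beta> \<mu>"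
  have \<eta>: "\<eta> > 0" using \<gamma> \<beta> \<mu>(1) by (simp add: \<eta>_def)
  obtain \<delta> where \<delta>: "\<delta> > 0"
    "\<And>y z. y \<in> closure \<Omega> \<Longrightarrow> z \<in> closure \<Omega> \<Longrightarrow> dist y z < \<delta> \<Longrightarrow> \<bar>u y - u z\<bar> < \<eta> \<and> \<bar>w y - w z\<bar> < \<eta>"
  proof -
    have uc: "uniformly_continuous_on (closure \<Omega>) u" "uniformly_continuous_on (closure \<Omega>) w"
      using vu(2) vw(2) comp by (auto intro: compact_uniformly_continuous)
    obtain d1 where d1: "d1 > 0"
      "\<forall>y\<in>closure \<Omega>. \<forall>z\<in>closure \<Omega>. dist z y < d1 \<longrightarrow> dist (u z) (u y) < \<eta>"
      using uc(1) \<eta> unfolding uniformly_continuous_on_def by blast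
    obtain d2 where d2: "d2 > 0"
      "\<forall>y\<in>closure \<Omega>. \<forall>z\<in>closure \<Omega>. dist z y < d2 \<longrightarrow> dist (w z) (w y) < \<eta>"
      using uc(2) \<eta> unfolding uniformly_continuous_on_def by blast
    show thesis using d1 d2 by (intro that[of "min d1 d2"]) (auto simp: dist_real_def)
  qed
  define r where "r = min \<rho> \<delta> / 4"
  have r: "r > 0" "3 * r \<le> \<rho>" "3 * r < \<delta>" using \<rho>(1) \<delta>(1) by (auto simp: r_def)
  define S where "S = (closure \<Omega> \<times> closure \<Omega>) \<inter> {p. dist (fst p) (snd p) \<le> 2 * r}"
  define G where "G p = u (fst p) powr a - (c * w (snd p)) powr a" for p
  have "continuous_on S (\<lambda>p. u (fst p))"
    by (rule continuous_on_compose2[OF vu(2) continuous_on_fst[OF continuous_on_id]]) (auto simp: S_def)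
  moreover have "continuous_on S (\<lambda>p. w (snd p))"
    by (rule continuous_on_compose2[OF vw(2) continuous_on_snd[OF continuous_on_id]]) (auto simp: S_def)
  ultimately have contG: "continuous_on S G"
    unfolding G_def using a unn wnn c(1)
    by (intro continuous_on_diff continuous_on_powr' continuous_on_mult continuous_on_const)
       (auto simp: S_def)
  have "compact S" unfolding S_def
    by (intro compact_Int_closed compact_Times comp closed_Collect_le continuous_intros)
  moreover have "(x, x) \<in> S" using x r by (auto simp: S_def)
  ultimately obtain p0 where p0: "p0 \<in> S" "\<And>p. p \<in> S \<Longrightarrow> G p \<le> G p0"
    using continuous_attains_sup[OF _ _ contG] by blast
  define y0 z0 where "y0 = fst p0" and "z0 = snd p0"
  define x0 where "x0 = midpoint y0 z0"
  define M where "M = G p0"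
  have y0: "y0 \<in> closure \<Omega>" and z0: "z0 \<in> closure \<Omega>" and yz: "dist y0 z0 \<le> 2 * r"
    using p0(1) by (auto simp: S_def y0_def z0_def)
  have Mmax: "u y powr a - (c * w z) powr a \<le> M"
    if "y \<in> closure \<Omega>" "z \<in> closure \<Omega>" "dist y z \<le> 2 * r" for y z
    using p0(2)[of "(y, z)"] that by (simp add: S_def G_def M_def)
  have MM0: "M0 \<le> M" using Mmax[OF x x] r by (simp add: M0_def)
  have M: "M > 0" using MM0 M0 by simp
  define B Q where "B = u y0" and "Q = w z0"
  have MBQ: "M = B powr a - (c * Q) powr a" by (simp add: M_def G_def B_def Q_def y0_def z0_def)
  have "M0 \<le> B powr a" using MBQ MM0 by (smt (verit) powr_ge_zero)
  then have "\<beta> \<le> (B powr a) powr (1 / a)" unfolding \<beta>_def using M0 a by (intro powr_mono2) auto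
  then have B: "\<beta> \<le> B" using a unn[OF y0] by (simp add: powr_powr B_def)
  then have y0K: "y0 \<in> K" using y0 by (simp add: K_def B_def)
  have xy: "dist x0 y0 \<le> r" and xz: "dist x0 z0 \<le> r"
    using yz by (auto simp: x0_def dist_midpoint)
  have cball_mono: "cball p t \<subseteq> cball q t'" if "dist p q \<le> s" "s + t \<le> t'" for p q :: 'a and s t t'
  proof
    fix v assume "v \<in> cball p t"
    then show "v \<in> cball q t'" using that dist_triangle[of q v p] by (simp add: dist_commute)
  qed
  have sub0: "cball x0 (2 * r) \<subseteq> cball y0 (3 * r)"
    using xy by (rule cball_mono) simp
  also have "\<dots> \<subseteq> cball y0 \<rho>" using r by auto
  also have "\<dots> \<subseteq> K'" using \<rho>(4) y0K by blast
  finally have subK: "cball x0 (2 * r) \<subseteq> K'" .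
  have sub\<Omega>: "cball x0 (2 * r) \<subseteq> \<Omega>" using subK \<rho>(3) by auto
  have subc: "cball x0 (2 * r) \<subseteq> closure \<Omega>" using sub\<Omega> closure_subset by (rule order_trans)
  have y0b: "y0 \<in> cball x0 (2 * r)" and z0b: "z0 \<in> cball x0 (2 * r)" and x0b: "x0 \<in> cball x0 (2 * r)"
    using xy xz r by auto
  have cu: "continuous_on (cball x0 (2 * r)) u" and cw: "continuous_on (cball x0 (2 * r)) w"
    by (rule continuous_on_subset[OF vu(2) subc], rule continuous_on_subset[OF vw(2) subc])
  obtain y1 where y1: "y1 \<in> cball x0 (2 * r)" "\<And>y. y \<in> cball x0 (2 * r) \<Longrightarrow> u y \<le> u y1"
    using continuous_attains_sup[OF compact_cball _ cu] x0b by auto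
  obtain z1 where z1: "z1 \<in> cball x0 (2 * r)" "\<And>y. y \<in> cball x0 (2 * r) \<Longrightarrow> w z1 \<le> w y"
    using continuous_attains_inf[OF compact_cball _ cw] x0b by auto
  define A C P R where "A = u x0" and "C = u y1" and "P = w x0" and "R = w z1"
  have near: "dist y z < \<delta>" if "y \<in> cball x0 (2 * r)" "dist x0 z \<le> r" for y z
    using that r dist_triangle3[of y z x0] by (simp add: dist_commute)
  have CB: "C < B + \<eta>"
    using \<delta>(2)[of y1 y0] near[OF y1(1) xy] y1(1) subc y0 by (force simp: C_def B_def)
  have QR: "Q < R + \<eta>"
    using \<delta>(2)[of z1 z0] near[OF z1(1) xz] z1(1) subc z0 by (force simp: Q_def R_def)
  have R: "\<mu> \<le> R" using \<mu>(2) z1(1) subK by (auto simp: R_def)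
  have RP: "R \<le> P" "R \<le> Q" and AC: "A \<le> C" "B \<le> C"
    using z1 x0b z0b y1 y0b by (auto simp: A_def B_def C_def P_def Q_def R_def)
  have pos: "0 < R" "0 < Q" "0 < P" "0 < B" "0 < C" "0 \<le> A"
    using R \<mu>(1) RP B \<beta> AC unn[OF subsetD[OF subc x0b]] by (auto simp: A_def)

  define T where "T t = (M + t powr a) powr (1 / a)" for t
  have le_T: "s \<le> T (c * t)" if "s powr a - (c * t) powr a \<le> M" "s \<ge> 0" for s t
  proof -
    have "(s powr a) powr (1 / a) \<le> T (c * t)"
      unfolding T_def using that(1) a by (intro powr_mono2) auto
    moreover have "(s powr a) powr (1 / a) = s" using that(2) a by (simp add: powr_powr)
    ultimately show ?thesis by simp
  qed
  have "x0 \<in> closure \<Omega>" "y1 \<in> closure \<Omega>" "z1 \<in> closure \<Omega>"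
    using subc x0b y1(1) z1(1) by blast+
  moreover have "dist x0 z1 \<le> 2 * r" "dist y1 x0 \<le> 2 * r"
    using y1(1) z1(1) by (auto simp: dist_commute)
  ultimately have "A powr a - (c * R) powr a \<le> M" "C powr a - (c * P) powr a \<le> M"
    using Mmax[of x0 z1] Mmax[of y1 x0] by (simp_all add: A_def R_def C_def P_def)
  then have A: "A \<le> T (c * R)" and C: "C \<le> T (c * P)" using pos by (simp_all add: le_T)
  have BT: "B = T (c * Q)" using pos a by (simp add: T_def MBQ powr_powr)

  have edge: "y \<in> cball x0 (2 * r) \<Longrightarrow> norm (y - x0) = 2 * r \<or> y \<in> interior (cball x0 (2 * r))" for y
    by (auto simp: dist_norm norm_minus_commute)

  have PQR: "P - Q \<le> Q - R"
  proof -
    define k where "k = (P - R) / (2 * r)"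
    have k: "k \<ge> 0" "k * (2 * r) = P - R" using RP r by (auto simp: k_def)
    have "w z0 \<ge> P - k * norm (z0 - x0)"
    proof (rule supersolution_above_cone[OF \<Omega> vw(1) compact_cball cw k(1) _ z0b])
      fix y assume y: "y \<in> cball x0 (2 * r)"
      show "P - k * norm (y - x0) \<le> w y \<or> y \<noteq> x0 \<and> y \<in> interior (cball x0 (2 * r)) \<and> y \<in> \<Omega>"
      proof (cases "y = x0 \<or> norm (y - x0) = 2 * r")
        case True
        then show ?thesis using z1(2)[OF y] k by (auto simp: P_def R_def)
      next
        case False
        then show ?thesis using edge[OF y] y sub\<Omega> by blast
      qed
    qed
    moreover have "k * norm (z0 - x0) \<le> k * r"
      using xz k by (intro mult_left_mono) (auto simp: dist_norm norm_minus_commute)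
    ultimately show ?thesis using k(2) by (simp add: Q_def)
  qed
  have dec: "r * (\<Lambda> * R powr l) \<le> Q - R"
  proof -
    have sub: "cball z0 r \<subseteq> cball x0 (2 * r)"
      using xz by (intro cball_mono[of _ _ r]) (auto simp: dist_commute)
    obtain y where "y \<in> cball z0 r" "w y \<le> w z0 - r * (lambda_1_inf \<Omega> * (R powr l))"
    proof (rule supersolution_decay[OF \<Omega> vw(1) r(1), of z0 R])
      show "cball z0 r \<subseteq> \<Omega>" using sub sub\<Omega> by blast
      show "R \<le> w y" if "y \<in> cball z0 r" for y using z1(2)[of y] that sub by (auto simp: R_def)
    qed (use pos l in auto)
    moreover from this have "R \<le> w y" using z1(2)[of y] sub by (auto simp: R_def)
    ultimately show ?thesis by (simp add: Q_def \<Lambda>_def)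
  qed
  have \<Lambda>pos: "\<Lambda> > 0" using \<Lambda> by (simp add: \<Lambda>_def)
  then have "r * (\<Lambda> * R powr l) > 0" using r pos by simp
  then have QRpos: "R < Q" using dec by linarith

  \<comment> \<open>The smallest slope admissible in both respects: for the gradient constraint and on the sphere.\<close>
  define k where "k = max (\<Lambda> * C powr l) ((C - A) / (2 * r))"
  have k: "k \<ge> 0" "C - A \<le> k * (2 * r)" "\<Lambda> * C powr l \<le> k"
  proof -
    show "\<Lambda> * C powr l \<le> k" by (simp add: k_def)
    moreover have "0 \<le> \<Lambda> * C powr l" using \<Lambda>pos by simp
    ultimately show "k \<ge> 0" by linarith
    have "(C - A) / (2 * r) \<le> k" by (simp add: k_def)
    then show "C - A \<le> k * (2 * r)" using r by (simp add: field_simps)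
  qed
  have "u y0 \<le> A + k * norm (y0 - x0)"
  proof (rule subsolution_below_cone[OF \<Omega> vu(1) u(2) compact_cball cu k(1) _ y0b])
    fix y assume y: "y \<in> cball x0 (2 * r)"
    have "u y powr m \<le> u y powr l"
      using u(2)[of y] vu(4)[of y] y sub\<Omega> l by (cases "u y = 0") (auto intro!: powr_mono')
    also have "\<dots> \<le> C powr l"
      using y1(2)[OF y] vu(4)[of y] y sub\<Omega> l by (auto simp: C_def intro!: powr_mono2)
    finally have "\<Lambda> * u y powr m \<le> \<Lambda> * C powr l" using \<Lambda>pos by simp
    then have um: "\<Lambda> * u y powr m \<le> k" using k(3) by linarith
    show "u y \<le> A + k * norm (y - x0) \<or> y \<noteq> x0 \<and> y \<in> interior (cball x0 (2 * r)) \<and> y \<in> \<Omega> \<and>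
        lambda_1_inf \<Omega> * (u y powr m) \<le> k"
    proof (cases "y = x0 \<or> norm (y - x0) = 2 * r")
      case True
      then show ?thesis using y1(2)[OF y] k by (auto simp: A_def C_def)
    next
      case False
      then show ?thesis using edge[OF y] y sub\<Omega> um unfolding \<Lambda>_def by blast
    qed
  qed
  moreover have "k * norm (y0 - x0) \<le> k * r"
    using xy k by (intro mult_left_mono) (auto simp: dist_norm norm_minus_commute)
  ultimately have BA: "B \<le> A + k * r" by (simp add: B_def)
  have cRQ: "0 < c * R" "c * R < c * Q" using pos QRpos c(1) by auto
  have lower: "(c * Q - c * R) * (B / (c * Q)) powr l < B - T (c * R)"
    using power_sum_secant_bounds(2)[OF M a cRQ, folded T_def] BT by (simp add: a_def)
  consider "k = (C - A) / (2 * r)" | "k = \<Lambda> * C powr l" unfolding k_def max_def by presburger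
  then show False
  proof cases
    case 1
    then have "k * r = (C - A) / 2" using r by simp
    then have "2 * B \<le> A + C" using BA by (simp add: field_simps)
    moreover have "T (c * P) \<le> T (c * Q + (c * Q - c * R))"
    proof -
      have "c * P \<le> c * (Q + (Q - R))" using PQR c(1) by (intro mult_left_mono) auto
      then show ?thesis unfolding T_def using a M pos c(1)
        by (intro powr_mono2 add_left_mono) (auto simp: algebra_simps)
    qed
    moreover have "T (c * Q + (c * Q - c * R)) - B < (c * Q - c * R) * (B / (c * Q)) powr l"
    proof -
      define d where "d = c * Q - c * R"
      have "0 < c * Q" "c * Q < c * Q + d" unfolding d_def using cRQ by linarith+
      from power_sum_secant_bounds(1)[OF M a this, folded T_def]
      show ?thesis unfolding d_def[symmetric] BT by (simp add: a_def)
    qed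
    ultimately show False using lower A C by linarith
  next
    case 2
    have sq: "sqrt \<gamma> > 1" "sqrt \<gamma> * sqrt \<gamma> = \<gamma>" using \<gamma> by auto
    have "\<eta> \<le> (sqrt \<gamma> - 1) * B" "\<eta> \<le> (sqrt \<gamma> - 1) * R"
      unfolding \<eta>_def using sq B R by (auto intro!: mult_left_mono)
    then have "C < sqrt \<gamma> * B" "Q < sqrt \<gamma> * R" using CB QR by (auto simp: algebra_simps)
    then have "C * Q < (sqrt \<gamma> * B) * (sqrt \<gamma> * R)" using pos by (intro mult_strict_mono) auto
    also have "\<dots> = \<gamma> * (B * R)" using sq(2) by (simp add: mult_ac)
    finally have "C < \<gamma> * (R * B / Q)" using pos by (simp add: field_simps)
    then have "C powr l < (\<gamma> * (R * B / Q)) powr l" using pos l by (intro powr_less_mono2) auto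
    also have "\<dots> = c powr a * (R * B / Q) powr l" 
      unfolding \<gamma>(2)[symmetric] by (rule powr_mult)
    finally have *: "C powr l < c powr a * (R * B / Q) powr l" .
    have "r * \<Lambda> * (c powr a * (R * B / Q) powr l) = c * (r * (\<Lambda> * R powr l)) * (B / (c * Q)) powr l"
    proof -
      have "c powr a = c / c powr l" using c(1) powr_diff[of c 1 l] by (simp add: a_def)
      moreover have "(R * B / Q) powr l = R powr l * B powr l / Q powr l"
        "(B / (c * Q)) powr l = B powr l / (c powr l * Q powr l)"
        using pos c(1) by (simp_all add: powr_mult powr_divide)
      ultimately show ?thesis by simp
    qed
    also have "\<dots> \<le> c * (Q - R) * (B / (c * Q)) powr l"
      using dec c(1) by (intro mult_right_mono mult_left_mono) auto
    also have "\<dots> < B - T (c * R)" using lower by (simp add: algebra_simps)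
    also have "\<dots> \<le> B - A" using A by simp
    also have "\<dots> \<le> r * \<Lambda> * C powr l" using BA 2 by (simp add: mult_ac)
    finally show False using * r \<Lambda>pos by simp
  qed
qed

section \<open>Positivity and Lipschitz bounds\<close>

text \<open>
  If \<open>w\<close> is positive at \<open>z\<close>, the cone from \<open>z\<close> that
  vanishes on a sphere inside the domain keeps \<open>w\<close> positive in the open ball. Hence
  the zero set is open as well as closed.
\<close>

lemma supersolution_positive:
  fixes w :: "'a::euclidean_space \<Rightarrow> real"
  assumes \<Omega>: "open \<Omega>" "bounded \<Omega>" "connected \<Omega>" and w: "viscosity_solution \<Omega> l w"
    and x1: "x1 \<in> \<Omega>" "w x1 > 0" and x: "x \<in> \<Omega>"
  shows "w x > 0"
proof -
  have cont: "continuous_on \<Omega> w" and nn: "\<And>y. y \<in> \<Omega> \<Longrightarrow> 0 \<le> w y"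
    using w unfolding viscosity_solution_def by blast+
  define S where "S = \<Omega> \<inter> w -` {0<..}"
  define T where "T = \<Omega> \<inter> w -` {0}"
  have S: "open S" unfolding S_def by (intro continuous_open_preimage cont \<Omega>) simp
  have T: "open T"
    unfolding open_contains_ball
  proof
    fix y assume y: "y \<in> T"
    then obtain d where d: "d > 0" "ball y d \<subseteq> \<Omega>" using \<Omega>(1) openE unfolding T_def by blast
    have "z \<in> T" if z: "z \<in> ball y (d / 2)" for z
    proof (rule ccontr)
      assume "z \<notin> T"
      have z\<Omega>: "z \<in> \<Omega>" using z d by auto
      with \<open>z \<notin> T\<close> nn[of z] have wz: "w z > 0" by (auto simp: T_def)
      \<comment> \<open>With this radius the ball around \<open>z\<close> contains \<open>y\<close> in its interior and stays in the domain.\<close>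
      define \<rho> where "\<rho> = d / 2"
      have \<rho>: "\<rho> > 0" using d by (simp add: \<rho>_def)
      have dzy: "dist y z < \<rho>" using z by (simp add: \<rho>_def)
      have sub: "cball z \<rho> \<subseteq> \<Omega>"
      proof
        fix v assume "v \<in> cball z \<rho>"
        then have "dist y v < \<rho> + \<rho>" using dist_triangle[of y v z] dzy by simp
        then show "v \<in> \<Omega>" using d(2) by (auto simp: \<rho>_def)
      qed
      have "w y \<ge> w z - (w z / \<rho>) * norm (y - z)"
      proof (rule supersolution_above_cone[OF \<Omega>(1,2) w compact_cball continuous_on_subset[OF cont sub]])
        show "0 \<le> w z / \<rho>" using wz \<rho> by simp
        show "y \<in> cball z \<rho>" using dzy by (simp add: dist_commute)
        fix v assume v: "v \<in> cball z \<rho>"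
        show "w z - w z / \<rho> * norm (v - z) \<le> w v \<or> v \<noteq> z \<and> v \<in> interior (cball z \<rho>) \<and> v \<in> \<Omega>"
        proof (cases "v = z \<or> dist z v = \<rho>")
          case True
          moreover have "0 \<le> w v" using nn subsetD[OF sub v] by blast
          ultimately show ?thesis using \<rho> by (auto simp: dist_norm norm_minus_commute)
        next
          case False
          then show ?thesis using v sub by auto
        qed
      qed
      moreover have "(w z / \<rho>) * norm (y - z) < (w z / \<rho>) * \<rho>"
        using wz \<rho> dzy by (intro mult_strict_left_mono) (auto simp: dist_norm)
      ultimately have "w y > 0" using \<rho> by simp
      then show False using y by (simp add: T_def)
    qed
    then show "\<exists>e>0. ball y e \<subseteq> T" using d(1) by (intro exI[of _ "d / 2"]) auto
  qed
  have "S \<inter> \<Omega> = {} \<or> T \<inter> \<Omega> = {}"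
  proof (rule connectedD[OF \<Omega>(3) S T])
    show "S \<inter> T \<inter> \<Omega> = {}" by (auto simp: S_def T_def)
    show "\<Omega> \<subseteq> S \<union> T"
    proof
      fix v assume "v \<in> \<Omega>"
      then show "v \<in> S \<union> T" using nn[of v] by (cases "w v = 0") (simp_all add: S_def T_def)
    qed
  qed
  moreover have "x1 \<in> S \<inter> \<Omega>" using x1 by (simp add: S_def)
  ultimately have "x \<notin> T" using x by blast
  then show ?thesis using x nn[OF x] by (auto simp: T_def)
qed

lemma subset_interior_closure: "open S \<Longrightarrow> x \<in> S \<Longrightarrow> x \<in> interior (closure S)"
  using interior_maximal[OF closure_subset] by blast

text \<open>
  If \<open>\<Lambda> \<le> 0\<close>, then the constant \<open>0\<close> is an admissible cone
  of slope \<open>0\<close>, which gives the maximum principle. The vertex is put outside the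
  closure so that it does not interfere.
\<close>

lemma subsolution_positive_imp_lambda_pos:
  fixes u :: "'a::euclidean_space \<Rightarrow> real"
  assumes \<Omega>: "open \<Omega>" "bounded \<Omega>" and u: "dirichlet_solution \<Omega> l u"
    and le: "\<And>x. x \<in> \<Omega> \<Longrightarrow> u x \<le> B" and x1: "x1 \<in> \<Omega>" "u x1 > 0"
  shows "lambda_1_inf \<Omega> > 0"
proof (rule ccontr)
  assume neg: "\<not> lambda_1_inf \<Omega> > 0"
  have vs: "viscosity_solution \<Omega> l u" "continuous_on (closure \<Omega>) u" "\<And>x. x \<in> frontier \<Omega> \<Longrightarrow> u x = 0"
    using u unfolding dirichlet_solution_def by blast+
  have "closure \<Omega> \<noteq> UNIV" using \<Omega>(2) bounded_closure not_bounded_UNIV by metis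
  then obtain z where z: "z \<notin> closure \<Omega>" by blast
  have "u x1 \<le> 0 + 0 * norm (x1 - z)"
  proof (rule subsolution_below_cone[OF \<Omega> vs(1) le])
    show "compact (closure \<Omega>)" using \<Omega>(2) by simp
    show "continuous_on (closure \<Omega>) u" by (rule vs(2))
    show "x1 \<in> closure \<Omega>" using x1(1) by (rule subsetD[OF closure_subset])
    fix y assume y: "y \<in> closure \<Omega>"
    show "u y \<le> 0 + 0 * norm (y - z) \<or>
      y \<noteq> z \<and> y \<in> interior (closure \<Omega>) \<and> y \<in> \<Omega> \<and> lambda_1_inf \<Omega> * u y powr l \<le> 0"
      using mem_closure_cases[OF \<Omega>(1) y]
    proof
      assume "y \<in> \<Omega>"
      moreover have "lambda_1_inf \<Omega> * u y powr l \<le> 0"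
        using neg by (intro mult_nonpos_nonneg) auto
      moreover have "y \<noteq> z" using y z by blast
      ultimately show ?thesis using subset_interior_closure[OF \<Omega>(1)] by blast
    qed (simp add: vs(3))
  qed auto
  then show False using x1(2) by simp
qed

text \<open>
  Since \<open>u \<le> 1\<close>, a cone of slope \<open>\<Lambda>\<close> with vertex at any
  point of the closure, boundary points included, is a barrier over the whole domain.
\<close>

lemma subsolution_lipschitz:
  fixes u :: "'a::euclidean_space \<Rightarrow> real"
  assumes \<Omega>: "open \<Omega>" "bounded \<Omega>" and \<Lambda>: "lambda_1_inf \<Omega> > 0" and l: "l \<ge> 0"
    and u: "dirichlet_solution \<Omega> l u" and le: "\<And>x. x \<in> \<Omega> \<Longrightarrow> u x \<le> 1"
    and xy: "x \<in> closure \<Omega>" "y \<in> closure \<Omega>"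
  shows "\<bar>u x - u y\<bar> \<le> lambda_1_inf \<Omega> * dist x y"
proof -
  have vs: "viscosity_solution \<Omega> l u" "continuous_on (closure \<Omega>) u" "\<And>x. x \<in> frontier \<Omega> \<Longrightarrow> u x = 0"
    "\<And>x. x \<in> \<Omega> \<Longrightarrow> 0 \<le> u x"
    using u unfolding dirichlet_solution_def viscosity_solution_def by blast+
  have nn: "0 \<le> u z" if "z \<in> closure \<Omega>" for z
    using mem_closure_cases[OF \<Omega>(1) that] vs(3,4) by force
  have main: "u y \<le> u z + lambda_1_inf \<Omega> * norm (y - z)"
    if z: "z \<in> closure \<Omega>" and y: "y \<in> closure \<Omega>" for y z
  proof (rule subsolution_below_cone[OF \<Omega> vs(1) le _ vs(2) _ _ y])
    show "compact (closure \<Omega>)" using \<Omega>(2) by simp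
    fix v assume v: "v \<in> closure \<Omega>"
    show "u v \<le> u z + lambda_1_inf \<Omega> * norm (v - z) \<or>
      v \<noteq> z \<and> v \<in> interior (closure \<Omega>) \<and> v \<in> \<Omega> \<and> lambda_1_inf \<Omega> * u v powr l \<le> lambda_1_inf \<Omega>"
    proof (cases "v = z")
      case False
      show ?thesis using mem_closure_cases[OF \<Omega>(1) v]
      proof
        assume v\<Omega>: "v \<in> \<Omega>"
        have "u v powr l \<le> 1 powr l" using le[OF v\<Omega>] vs(4)[OF v\<Omega>] l by (intro powr_mono2) auto
        then have "lambda_1_inf \<Omega> * u v powr l \<le> lambda_1_inf \<Omega>" using \<Lambda> by simp
        then show ?thesis using v\<Omega> False subset_interior_closure[OF \<Omega>(1)] by blast
      next
        assume "v \<in> frontier \<Omega>"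
        then have "u v = 0" by (rule vs(3))
        moreover have "0 \<le> lambda_1_inf \<Omega> * norm (v - z)" using \<Lambda> by simp
        ultimately show ?thesis using nn[OF z] by simp
      qed
    qed simp
  qed (use \<Lambda> in auto)
  have "u x - u y \<le> lambda_1_inf \<Omega> * dist x y" using main[OF xy(2,1)] by (simp add: dist_norm)
  moreover have "u y - u x \<le> lambda_1_inf \<Omega> * dist x y"
    using main[OF xy] by (simp add: dist_norm norm_minus_commute)
  ultimately show ?thesis by (simp add: abs_le_iff)
qed

text \<open>
  A segment leaving the domain meets the boundary, where the function vanishes.
\<close>

lemma lipschitz_zero_extension:
  fixes V :: "'a::euclidean_space \<Rightarrow> real"
  assumes \<Omega>: "open \<Omega>" and lip: "\<And>x y. x \<in> closure \<Omega> \<Longrightarrow> y \<in> closure \<Omega> \<Longrightarrow> \<bar>V x - V y\<bar> \<le> L * dist x y"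
    and L: "L \<ge> 0" and zero: "\<And>x. x \<notin> \<Omega> \<Longrightarrow> V x = 0"
  shows "\<bar>V x - V y\<bar> \<le> L * dist x y"
proof -
  have mixed: "\<bar>V x\<bar> \<le> L * dist x y" if x: "x \<in> \<Omega>" and y: "y \<notin> \<Omega>" for x y
  proof -
    have "closed_segment x y \<inter> frontier \<Omega> \<noteq> {}"
    proof (rule connected_Int_frontier)
      show "closed_segment x y \<inter> \<Omega> \<noteq> {}" "closed_segment x y - \<Omega> \<noteq> {}" using x y by auto
    qed simp
    then obtain z where z: "z \<in> closed_segment x y" "z \<in> frontier \<Omega>" by blast
    have "z \<notin> \<Omega>" using z(2) \<Omega> by (simp add: frontier_def interior_open)
    then have "V z = 0" by (rule zero)
    moreover have "z \<in> closure \<Omega>" using z(2) by (simp add: frontier_def)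
    moreover have "x \<in> closure \<Omega>" using x by (rule subsetD[OF closure_subset])
    ultimately have "\<bar>V x\<bar> \<le> L * dist x z" using lip[of x z] by simp
    also have "\<dots> \<le> L * dist x y"
      using segment_bound(1)[OF z(1)] L by (intro mult_left_mono) (simp_all add: dist_norm norm_minus_commute)
    finally show ?thesis .
  qed
  consider "x \<in> \<Omega>" "y \<in> \<Omega>" | "x \<in> \<Omega>" "y \<notin> \<Omega>" | "x \<notin> \<Omega>" "y \<in> \<Omega>" | "x \<notin> \<Omega>" "y \<notin> \<Omega>" by blast
  then show ?thesis
  proof cases
    case 1
    then show ?thesis using lip subsetD[OF closure_subset] by (metis (no_types))
  next
    case 2
    then show ?thesis using mixed[of x y] zero[of y] by simp
  next
    case 3
    then show ?thesis using mixed[of y x] zero[of x] by (simp add: dist_commute)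
  next
    case 4
    then show ?thesis using zero L by simp
  qed
qed

section \<open>Stability under uniform convergence\<close>

lemma C2_continuous:
  assumes "Ck_on 2 S \<phi>"
  shows "continuous_on S \<phi>" "continuous_on S (grad \<phi>)" "continuous_on S (inf_laplacian \<phi>)"
proof -
  have C: "\<forall>x\<in>S. \<phi> differentiable (at x)"
    "\<forall>i\<in>Basis. (\<forall>x\<in>S. partial_deriv i \<phi> differentiable (at x)) \<and>
      (\<forall>j\<in>Basis. continuous_on S (partial_deriv j (partial_deriv i \<phi>)))"
    using assms unfolding numeral_2_eq_2 Ck_on.simps by blast+
  show "continuous_on S \<phi>"
    using C(1) by (intro continuous_at_imp_continuous_on ballI differentiable_imp_continuous_within) blast
  have 1: "continuous_on S (partial_deriv i \<phi>)" if "i \<in> Basis" for i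
    using C(2) that by (intro continuous_at_imp_continuous_on ballI differentiable_imp_continuous_within) blast
  have 2: "continuous_on S (partial_deriv j (partial_deriv i \<phi>))" if "i \<in> Basis" "j \<in> Basis" for i j
    using C(2) that by blast
  have "continuous_on S (\<lambda>x. \<Sum>i\<in>Basis. partial_deriv i \<phi> x *\<^sub>R i)"
    by (intro continuous_on_sum continuous_on_scaleR continuous_on_const 1)
  then show "continuous_on S (grad \<phi>)" by (simp only: grad_def[abs_def])
  have "continuous_on S (\<lambda>x. \<Sum>i\<in>Basis. \<Sum>j\<in>Basis.
        partial_deriv j \<phi> x * partial_deriv j (partial_deriv i \<phi>) x * partial_deriv i \<phi> x)"
    by (intro continuous_on_sum continuous_on_mult 1 2)
  then show "continuous_on S (inf_laplacian \<phi>)" by (simp only: inf_laplacian_def[abs_def])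
qed

text \<open>
  Maximisers of the approximating functions over a fixed closed ball cannot stay away from
  \<open>x0\<close>, where the limit has its only maximum.
\<close>

lemma strict_max_stable:
  fixes F :: "'a::euclidean_space \<Rightarrow> real"
  assumes \<Omega>: "open \<Omega>" and x0: "x0 \<in> \<Omega>"
    and F: "continuous_on \<Omega> F" and Fn: "\<And>n. continuous_on \<Omega> (Fn n)"
    and lim: "uniform_limit \<Omega> Fn F sequentially"
    and strict: "\<And>x. x \<in> \<Omega> \<Longrightarrow> x \<noteq> x0 \<Longrightarrow> F x < F x0"
  shows "\<exists>X. X \<longlonglongrightarrow> x0 \<and> (\<forall>n. X n \<in> \<Omega>) \<and>
    (\<forall>\<^sub>F n in sequentially. \<exists>r>0. \<forall>x\<in>\<Omega>. dist x (X n) < r \<longrightarrow> Fn n x \<le> Fn n (X n))"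
proof -
  obtain r where r: "r > 0" "cball x0 r \<subseteq> \<Omega>" using \<Omega> x0 open_contains_cball by blast
  have "\<exists>y\<in>cball x0 r. \<forall>x\<in>cball x0 r. Fn n x \<le> Fn n y" for n
    using r by (intro continuous_attains_sup continuous_on_subset[OF Fn]) auto
  then obtain X where X: "\<forall>n. X n \<in> cball x0 r \<and> (\<forall>x\<in>cball x0 r. Fn n x \<le> Fn n (X n))"
    using bchoice[of UNIV "\<lambda>n y. y \<in> cball x0 r \<and> (\<forall>x\<in>cball x0 r. Fn n x \<le> Fn n y)"] by blast
  have near: "\<forall>\<^sub>F n in sequentially. dist (X n) x0 < \<rho>" if \<rho>: "\<rho> > 0" for \<rho>
  proof -
    define A where "A = cball x0 r - ball x0 \<rho>"
    have "compact A" unfolding A_def by (intro compact_diff compact_cball open_ball)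
    have Asub: "A \<subseteq> \<Omega>" using r by (auto simp: A_def)
    \<comment> \<open>Away from \<open>x0\<close> the limit stays below its maximum by a gap \<open>m\<close>, which small perturbations respect.\<close>
    obtain m where m: "m > 0" "\<And>x. x \<in> A \<Longrightarrow> F x \<le> F x0 - m"
    proof (cases "A = {}")
      case False
      then obtain y where y: "y \<in> A" "\<forall>x\<in>A. F x \<le> F y"
        using continuous_attains_sup[OF \<open>compact A\<close> False continuous_on_subset[OF F Asub]] by blast
      have "y \<noteq> x0" using y(1) \<rho> by (auto simp: A_def)
      then have "F y < F x0" using strict y(1) Asub by blast
      then show thesis using y(2) by (intro that[of "F x0 - F y"]) auto
    qed (use that[of 1] in auto)
    have "m / 2 > 0" using m(1) by simp
    from uniform_limitD[OF lim this] show ?thesis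
    proof eventually_elim
      case (elim n)
      have "X n \<notin> A"
      proof
        assume XA: "X n \<in> A"
        have "Fn n x0 \<le> Fn n (X n)" using X r by simp
        moreover have "dist (Fn n x0) (F x0) < m / 2" "dist (Fn n (X n)) (F (X n)) < m / 2"
          using elim x0 XA Asub by blast+
        moreover have "F (X n) \<le> F x0 - m" by (rule m(2)[OF XA])
        ultimately show False unfolding dist_real_def by argo
      qed
      then show ?case using X by (auto simp: A_def dist_commute)
    qed
  qed
  have "X \<longlonglongrightarrow> x0" by (rule tendstoI) (rule near)
  moreover have "\<forall>n. X n \<in> \<Omega>" using X r by blast
  moreover have "\<forall>\<^sub>F n in sequentially. \<exists>d>0. \<forall>x\<in>\<Omega>. dist x (X n) < d \<longrightarrow> Fn n x \<le> Fn n (X n)"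
    using near[OF r(1)]
  proof eventually_elim
    case (elim n)
    have "Fn n x \<le> Fn n (X n)" if "dist x (X n) < r - dist (X n) x0" for x
    proof -
      have "dist x0 x \<le> r" using that dist_triangle[of x0 x "X n"] by (simp add: dist_commute)
      then show ?thesis using X by simp
    qed
    then show ?case using elim by (intro exI[of _ "r - dist (X n) x0"]) auto
  qed
  ultimately show ?thesis by blast
qed

text \<open>
  A test function touching the limit strictly at \<open>x0\<close> touches, up to a constant,
  the approximating functions at points converging to \<open>x0\<close>. The viscosity
  inequalities pass to the limit because the 2-jet of the test function is continuous.
\<close>

lemma viscosity_solution_stable:
  fixes u :: "nat \<Rightarrow> 'a::euclidean_space \<Rightarrow> real"
  assumes \<Omega>: "open \<Omega>" and u: "\<And>n. viscosity_solution \<Omega> (l n) (u n)"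
    and l: "l \<longlonglongrightarrow> m" "m > 0" and lim: "uniform_limit \<Omega> u V sequentially"
  shows "viscosity_solution \<Omega> m V"
proof -
  have uc: "continuous_on \<Omega> (u n)" and unn: "x \<in> \<Omega> \<Longrightarrow> 0 \<le> u n x" for n x
    using u[of n] unfolding viscosity_solution_def by blast+
  have Vc: "continuous_on \<Omega> V"
    by (rule uniform_limit_theorem[OF _ lim]) (simp_all add: uc)
  have ptw: "(\<lambda>n. u n x) \<longlonglongrightarrow> V x" if "x \<in> \<Omega>" for x
    using tendsto_uniform_limitI[OF lim that] .
  have Vnn: "0 \<le> V x" if "x \<in> \<Omega>" for x
    by (rule LIMSEQ_le_const[OF ptw[OF that]]) (use unn that in blast)
  have along: "(\<lambda>n. u n (X n) powr l n) \<longlonglongrightarrow> V x0 powr m"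
    if X: "X \<longlonglongrightarrow> x0" "\<forall>n. X n \<in> \<Omega>" and x0: "x0 \<in> \<Omega>" for X x0
  proof (rule tendsto_powr')
    have "(\<lambda>n. V (X n)) \<longlonglongrightarrow> V x0"
      by (rule continuous_on_tendsto_compose[OF Vc X(1) x0]) (use X(2) in simp)
    moreover have "(\<lambda>n. u n (X n) - V (X n)) \<longlonglongrightarrow> 0"
    proof (rule tendstoI)
      fix e :: real assume "e > 0"
      from uniform_limitD[OF lim this]
      show "\<forall>\<^sub>F n in sequentially. dist (u n (X n) - V (X n)) 0 < e"
        by eventually_elim (use X(2) in \<open>simp add: dist_real_def\<close>)
    qed
    ultimately have "(\<lambda>n. (u n (X n) - V (X n)) + V (X n)) \<longlonglongrightarrow> 0 + V x0" by (intro tendsto_add)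
    then show "(\<lambda>n. u n (X n)) \<longlonglongrightarrow> V x0" by simp
    show "V x0 \<noteq> 0 \<or> 0 < m \<and> (\<forall>\<^sub>F n in sequentially. 0 \<le> u n (X n))"
      using l(2) unn X(2) by (simp add: always_eventually)
  qed (rule l(1))
  have close: "\<forall>\<^sub>F n in sequentially. \<forall>x\<in>\<Omega>. \<bar>u n x - V x\<bar> < 1"
    using uniform_limitD[OF lim, of 1] by (simp add: dist_real_def)
  show ?thesis
    unfolding viscosity_solution_def
  proof (intro conjI ballI allI impI)
    show "continuous_on \<Omega> V" by (rule Vc)
    show "\<And>x. x \<in> \<Omega> \<Longrightarrow> 0 \<le> V x" by (rule Vnn)
  next
    fix x0 \<phi> assume x0: "x0 \<in> \<Omega>"
      and \<phi>: "Ck_on 2 \<Omega> \<phi> \<and> V x0 = \<phi> x0 \<and> (\<forall>x\<in>\<Omega> - {x0}. V x < \<phi> x)"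
    have C2: "Ck_on 2 \<Omega> \<phi>" and V0: "V x0 = \<phi> x0" and strict: "\<And>x. x \<in> \<Omega> \<Longrightarrow> x \<noteq> x0 \<Longrightarrow> V x < \<phi> x"
      using \<phi> by blast+
    note cont = C2_continuous[OF C2]
    have "\<exists>X. X \<longlonglongrightarrow> x0 \<and> (\<forall>n. X n \<in> \<Omega>) \<and>
      (\<forall>\<^sub>F n in sequentially. \<exists>r>0. \<forall>x\<in>\<Omega>. dist x (X n) < r \<longrightarrow> u n x - \<phi> x \<le> u n (X n) - \<phi> (X n))"
    proof (rule strict_max_stable[OF \<Omega> x0, of "\<lambda>x. V x - \<phi> x"])
      show "uniform_limit \<Omega> (\<lambda>n x. u n x - \<phi> x) (\<lambda>x. V x - \<phi> x) sequentially"
        by (intro uniform_limit_minus lim uniform_limit_const)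
    qed (use strict V0 in \<open>auto intro!: continuous_on_diff Vc uc cont\<close>)
    then obtain X where X: "X \<longlonglongrightarrow> x0" "\<forall>n. X n \<in> \<Omega>" and tch:
      "\<forall>\<^sub>F n in sequentially. \<exists>r>0. \<forall>x\<in>\<Omega>. dist x (X n) < r \<longrightarrow> u n x - \<phi> x \<le> u n (X n) - \<phi> (X n)"
      by blast
    have lapl: "(\<lambda>n. inf_laplacian \<phi> (X n)) \<longlonglongrightarrow> inf_laplacian \<phi> x0"
      by (rule continuous_on_tendsto_compose[OF cont(3) X(1) x0]) (use X(2) in simp)
    have "(\<lambda>n. grad \<phi> (X n)) \<longlonglongrightarrow> grad \<phi> x0"
      by (rule continuous_on_tendsto_compose[OF cont(2) X(1) x0]) (use X(2) in simp)
    then have gr: "(\<lambda>n. norm (grad \<phi> (X n)) - lambda_1_inf \<Omega> * (u n (X n) powr l n))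
        \<longlonglongrightarrow> norm (grad \<phi> x0) - lambda_1_inf \<Omega> * (V x0 powr m)"
      by (intro tendsto_diff tendsto_norm tendsto_mult tendsto_const along X x0)
    have alt: "\<forall>\<^sub>F n in sequentially. inf_laplacian \<phi> (X n) \<ge> 0 \<or>
        norm (grad \<phi> (X n)) \<le> lambda_1_inf \<Omega> * (u n (X n) powr l n)"
      using tch close
    proof eventually_elim
      case (elim n)
      then obtain r where r: "r > 0"
        "\<forall>x\<in>\<Omega>. dist x (X n) < r \<longrightarrow> u n x - \<phi> x \<le> u n (X n) - \<phi> (X n)" by blast
      show ?case
      proof (rule viscosity_touch_above[OF \<Omega> u X(2)[rule_format] C2 r(1)])
        fix x assume x: "x \<in> \<Omega>"
        show "dist x (X n) < r \<Longrightarrow> u n x - \<phi> x \<le> u n (X n) - \<phi> (X n)" using r(2) x by blast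
        have "V x \<le> \<phi> x" using strict[OF x] V0 by (cases "x = x0") auto
        moreover have "\<bar>u n x - V x\<bar> < 1" using elim(2) x by blast
        ultimately show "u n x \<le> \<phi> x + 1" by argo
      qed
    qed
    show "- inf_laplacian \<phi> x0 \<le> 0 \<or> norm (grad \<phi> x0) - lambda_1_inf \<Omega> * \<phi> x0 powr m \<le> 0"
    proof (rule ccontr)
      assume "\<not> ?thesis"
      then have neg: "inf_laplacian \<phi> x0 < 0" "0 < norm (grad \<phi> x0) - lambda_1_inf \<Omega> * V x0 powr m"
        by (simp_all add: V0)
      have "\<forall>\<^sub>F n in sequentially. False"
        using order_tendstoD(2)[OF lapl neg(1)] order_tendstoD(1)[OF gr neg(2)] alt
        by eventually_elim auto
      then show False by simp
    qed
  next
    fix x0 \<phi> assume x0: "x0 \<in> \<Omega>"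
      and \<phi>: "Ck_on 2 \<Omega> \<phi> \<and> V x0 = \<phi> x0 \<and> (\<forall>x\<in>\<Omega> - {x0}. V x > \<phi> x)"
    have C2: "Ck_on 2 \<Omega> \<phi>" and V0: "V x0 = \<phi> x0" and strict: "\<And>x. x \<in> \<Omega> \<Longrightarrow> x \<noteq> x0 \<Longrightarrow> V x > \<phi> x"
      using \<phi> by blast+
    note cont = C2_continuous[OF C2]
    have "\<exists>X. X \<longlonglongrightarrow> x0 \<and> (\<forall>n. X n \<in> \<Omega>) \<and>
      (\<forall>\<^sub>F n in sequentially. \<exists>r>0. \<forall>x\<in>\<Omega>. dist x (X n) < r \<longrightarrow> \<phi> x - u n x \<le> \<phi> (X n) - u n (X n))"
    proof (rule strict_max_stable[OF \<Omega> x0, of "\<lambda>x. \<phi> x - V x"])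
      show "uniform_limit \<Omega> (\<lambda>n x. \<phi> x - u n x) (\<lambda>x. \<phi> x - V x) sequentially"
        by (intro uniform_limit_minus lim uniform_limit_const)
    qed (use strict V0 in \<open>auto intro!: continuous_on_diff Vc uc cont\<close>)
    then obtain X where X: "X \<longlonglongrightarrow> x0" "\<forall>n. X n \<in> \<Omega>" and tch:
      "\<forall>\<^sub>F n in sequentially. \<exists>r>0. \<forall>x\<in>\<Omega>. dist x (X n) < r \<longrightarrow> \<phi> x - u n x \<le> \<phi> (X n) - u n (X n)"
      by blast
    have lapl: "(\<lambda>n. inf_laplacian \<phi> (X n)) \<longlonglongrightarrow> inf_laplacian \<phi> x0"
      by (rule continuous_on_tendsto_compose[OF cont(3) X(1) x0]) (use X(2) in simp)
    have "(\<lambda>n. grad \<phi> (X n)) \<longlonglongrightarrow> grad \<phi> x0"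
      by (rule continuous_on_tendsto_compose[OF cont(2) X(1) x0]) (use X(2) in simp)
    then have gr: "(\<lambda>n. norm (grad \<phi> (X n)) - lambda_1_inf \<Omega> * (u n (X n) powr l n))
        \<longlonglongrightarrow> norm (grad \<phi> x0) - lambda_1_inf \<Omega> * (V x0 powr m)"
      by (intro tendsto_diff tendsto_norm tendsto_mult tendsto_const along X x0)
    have alt: "\<forall>\<^sub>F n in sequentially. inf_laplacian \<phi> (X n) \<le> 0 \<and>
        norm (grad \<phi> (X n)) \<ge> lambda_1_inf \<Omega> * (u n (X n) powr l n)"
      using tch close
    proof eventually_elim
      case (elim n)
      then obtain r where r: "r > 0"
        "\<forall>x\<in>\<Omega>. dist x (X n) < r \<longrightarrow> \<phi> x - u n x \<le> \<phi> (X n) - u n (X n)" by blast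
      show ?case
      proof (rule viscosity_touch_below[OF \<Omega> u X(2)[rule_format] C2 r(1)])
        fix x assume x: "x \<in> \<Omega>"
        show "u n (X n) - \<phi> (X n) \<le> u n x - \<phi> x" if "dist x (X n) < r"
          using r(2)[rule_format, OF x that] by argo
        have "\<phi> x \<le> V x" using strict[OF x] V0 by (cases "x = x0") auto
        moreover have "\<bar>u n x - V x\<bar> < 1" using elim(2) x by blast
        ultimately show "\<phi> x \<le> u n x + 1" by argo
      qed
    qed
    show "- inf_laplacian \<phi> x0 \<ge> 0"
    proof -
      have "inf_laplacian \<phi> x0 \<le> 0"
        by (rule tendsto_upperbound[OF lapl]) (use alt in \<open>eventually_elim; simp\<close>, simp)
      then show ?thesis by simp
    qed
    have "0 \<le> norm (grad \<phi> x0) - lambda_1_inf \<Omega> * (V x0 powr m)"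
      by (rule tendsto_lowerbound[OF gr]) (use alt in \<open>eventually_elim; simp\<close>, simp)
    then show "norm (grad \<phi> x0) - lambda_1_inf \<Omega> * \<phi> x0 powr m \<ge> 0" by (simp add: V0)
  qed
qed

section \<open>Weak gradients of Lipschitz functions\<close>

text \<open>
  An elementary substitute for weak compactness in \<open>L\<^sup>2\<close>. Let \<open>C
  k\<close> consist of the functions bounded by \<open>K\<close> that lie in every half-space,
  given by an integrable \<open>\<phi>\<close>, containing all \<open>f j\<close> with \<open>j
  \<ge> k\<close>. These convex sets decrease, so their minimal \<open>L\<^sup>2\<close> norms
  increase to a finite limit, and by the parallelogram law almost minimal elements form a Cauchy
  sequence. Its limit has every weak limit that the original sequence has.
\<close>

lemma bounded_weak_limit:
  fixes f :: "nat \<Rightarrow> 'a \<Rightarrow> real"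
  assumes "finite_measure M" and meas: "\<And>j. f j \<in> borel_measurable M"
    and bd: "\<And>j x. \<bar>f j x\<bar> \<le> K"
  shows "\<exists>g. g \<in> borel_measurable M \<and> (\<forall>x. \<bar>g x\<bar> \<le> K) \<and>
    (\<forall>\<phi> L. integrable M \<phi> \<longrightarrow> (\<lambda>j. \<integral>x. f j x * \<phi> x \<partial>M) \<longlonglongrightarrow> L \<longrightarrow> (\<integral>x. g x * \<phi> x \<partial>M) = L)"
proof -
  interpret finite_measure M by fact
  have K: "K \<ge> 0" using bd[of 0 undefined] by linarith
  define C where "C k = {h. h \<in> borel_measurable M \<and> (\<forall>x. \<bar>h x\<bar> \<le> K) \<and>
    (\<forall>\<phi> B. integrable M \<phi> \<longrightarrow> (\<forall>j\<ge>k. (\<integral>x. f j x * \<phi> x \<partial>M) \<le> B) \<longrightarrow> (\<integral>x. h x * \<phi> x \<partial>M) \<le> B)}" for k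
  define N where "N h = (\<integral>x. (h x)\<^sup>2 \<partial>M)" for h :: "'a \<Rightarrow> real"
  define m where "m k = (INF h\<in>C k. N h)" for k
  have Cmeas: "h \<in> borel_measurable M" and Cbd: "\<bar>h x\<bar> \<le> K" if "h \<in> C k" for h k x
    using that by (auto simp: C_def)
  have Ctest: "(\<integral>x. h x * \<phi> x \<partial>M) \<le> B"
    if "h \<in> C k" "integrable M \<phi>" "\<forall>j\<ge>k. (\<integral>x. f j x * \<phi> x \<partial>M) \<le> B" for h k \<phi> B
    using that unfolding C_def by blast
  have int: "integrable M (\<lambda>x. h x * \<phi> x)" if "h \<in> C k" "integrable M \<phi>" for h k \<phi>
  proof (rule Bochner_Integration.integrable_bound[of M "\<lambda>x. K * \<phi> x"])
    show "integrable M (\<lambda>x. K * \<phi> x)" using that(2) by simp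
    show "(\<lambda>x. h x * \<phi> x) \<in> borel_measurable M"
      using Cmeas[OF that(1)] borel_measurable_integrable[OF that(2)] by simp
    show "AE x in M. norm (h x * \<phi> x) \<le> norm (K * \<phi> x)"
      using Cbd[OF that(1)] K by (auto simp: abs_mult intro!: mult_right_mono)
  qed
  have intb: "integrable M h" if "h \<in> C k" for h k
    using Cmeas[OF that] Cbd[OF that] by (intro integrable_const_bound[of _ K]) auto
  have int2: "integrable M (\<lambda>x. h x * h' x)" if "h \<in> C k" "h' \<in> C k'" for h h' k k'
    by (rule int[OF that(1) intb[OF that(2)]])
  have fC: "f j \<in> C k" if "k \<le> j" for j k
    using that meas bd by (auto simp: C_def)
  have anti: "C k' \<subseteq> C k" if "k \<le> k'" for k k'
    using that unfolding C_def by (auto 0 3)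
  have mid: "(\<lambda>x. (h x + h' x) / 2) \<in> C k" if "h \<in> C k" "h' \<in> C k" for h h' k
    unfolding C_def
  proof (intro CollectI conjI allI impI)
    show "(\<lambda>x. (h x + h' x) / 2) \<in> borel_measurable M" using Cmeas that by simp
    show "\<bar>(h x + h' x) / 2\<bar> \<le> K" for x using Cbd[OF that(1), of x] Cbd[OF that(2), of x] by auto
    fix \<phi> B assume \<phi>: "integrable M \<phi>" "\<forall>j\<ge>k. (\<integral>x. f j x * \<phi> x \<partial>M) \<le> B"
    have "(\<integral>x. (h x + h' x) / 2 * \<phi> x \<partial>M) = (\<integral>x. (h x * \<phi> x) / 2 + (h' x * \<phi> x) / 2 \<partial>M)"
      by (rule Bochner_Integration.integral_cong) (auto simp: field_simps)
    also have "\<dots> = (\<integral>x. h x * \<phi> x \<partial>M) / 2 + (\<integral>x. h' x * \<phi> x \<partial>M) / 2"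
      using int[OF that(1) \<phi>(1)] int[OF that(2) \<phi>(1)] by (subst Bochner_Integration.integral_add) auto
    also have "\<dots> \<le> B" using Ctest[OF that(1) \<phi>] Ctest[OF that(2) \<phi>] by linarith
    finally show "(\<integral>x. (h x + h' x) / 2 * \<phi> x \<partial>M) \<le> B" .
  qed
  have N0: "0 \<le> N h" for h by (simp add: N_def)
  have bdd: "bdd_below (N ` C k)" for k using N0 by (auto intro!: bdd_belowI[of _ 0])
  have ND: "N h \<le> K\<^sup>2 * measure M (space M)" if "h \<in> C k" for h k
  proof -
    have "N h \<le> (\<integral>x. K\<^sup>2 \<partial>M)" unfolding N_def
    proof (rule integral_mono)
      show "integrable M (\<lambda>x. (h x)\<^sup>2)" using int2[OF that that] by (simp add: power2_eq_square)
      show "(h x)\<^sup>2 \<le> K\<^sup>2" for x using power_mono[OF Cbd[OF that, of x], of 2] by simp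
    qed simp
    then show ?thesis by (simp add: mult.commute)
  qed
  have m_le: "m k \<le> N h" if "h \<in> C k" for h k
    unfolding m_def using bdd that by (rule cINF_lower)
  have m_mono: "m k \<le> m k'" if "k \<le> k'" for k k'
    unfolding m_def using anti[OF that] fC[of k' k'] by (intro cINF_superset_mono bdd) auto
  have m_le_D: "\<forall>k. m k \<le> K\<^sup>2 * measure M (space M)"
    using m_le[OF fC[OF order_refl]] ND[OF fC[OF order_refl]] order_trans by blast
  have "incseq m" using m_mono by (simp add: incseq_def)
  from incseq_convergent[OF this m_le_D] obtain lm where "m \<longlonglongrightarrow> lm" by blast
  then have Cm: "Cauchy m" by (rule LIMSEQ_imp_Cauchy)
  have "\<exists>h\<in>C k. N h < m k + 1 / real (Suc k)" for k
    using cINF_less_iff[OF _ bdd, of k "m k + 1 / real (Suc k)"] fC[of k k] by (auto simp: m_def)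
  then obtain h where h: "\<And>k. h k \<in> C k" "\<And>k. N (h k) < m k + 1 / real (Suc k)" by metis
  have par: "(\<integral>x. (h k x - h j x)\<^sup>2 \<partial>M) \<le> 2 * (m j - m k) + 4 / real (Suc k)" if kj: "k \<le> j" for k j
  proof -
    have hj: "h j \<in> C k" using h(1)[of j] anti[OF kj] by blast
    define p where "p x = (h k x + h j x) / 2" for x
    have p: "p \<in> C k" unfolding p_def by (rule mid[OF h(1) hj])
    have id: "(a - b)\<^sup>2 = 2 * (a * a) + 2 * (b * b) - 4 * ((a + b) / 2 * ((a + b) / 2))" for a b :: real
      by (simp add: power2_eq_square algebra_simps)
    have i1: "integrable M (\<lambda>x. 2 * (h k x * h k x))" and i2: "integrable M (\<lambda>x. 2 * (h j x * h j x))"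
      and i3: "integrable M (\<lambda>x. 4 * (p x * p x))"
      using int2[OF h(1) h(1)] int2[OF p p] by simp_all
    have "(\<integral>x. (h k x - h j x)\<^sup>2 \<partial>M)
        = (\<integral>x. 2 * (h k x * h k x) + 2 * (h j x * h j x) - 4 * (p x * p x) \<partial>M)"
      unfolding id p_def ..
    also have "\<dots> = 2 * N (h k) + 2 * N (h j) - 4 * N p"
      unfolding N_def power2_eq_square Bochner_Integration.integral_diff[OF Bochner_Integration.integrable_add[OF i1 i2] i3]
        Bochner_Integration.integral_add[OF i1 i2] by simp
    finally have eq: "(\<integral>x. (h k x - h j x)\<^sup>2 \<partial>M) = 2 * N (h k) + 2 * N (h j) - 4 * N p" .
    define d where "d = 1 / real (Suc k)"
    have "1 / real (Suc j) \<le> d" unfolding d_def using kj by (simp add: frac_le)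
    then have "N (h j) < m j + d" using h(2)[of j] by linarith
    moreover have "N (h k) < m k + d" using h(2)[of k] by (simp only: d_def)
    ultimately have "(\<integral>x. (h k x - h j x)\<^sup>2 \<partial>M) \<le> 2 * (m j - m k) + 4 * d"
      using eq m_le[OF p] by (smt (verit))
    then show ?thesis by (simp add: d_def)
  qed
  have L1: "\<exists>n0. \<forall>i\<ge>n0. \<forall>j\<ge>n0. (\<integral>x. norm (h i x - h j x) \<partial>M) < e" if e: "e > 0" for e
  proof -
    define \<mu> where "\<mu> = measure M (space M)"
    \<comment> \<open>The weight in \<open>d \<le> (d\<^sup>2 / \<eta> + \<eta>) / 2\<close>, by which the \<open>L\<^sup>2\<close> estimate yields the \<open>L\<^sup>1\<close> estimate.\<close>
    define \<eta> where "\<eta> = e / (\<mu> + 1)"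
    have \<mu>: "\<mu> \<ge> 0" by (simp add: \<mu>_def)
    have \<eta>: "\<eta> > 0" unfolding \<eta>_def using e \<mu> by (intro divide_pos_pos) auto
    have "\<eta> * e / 4 > 0" using \<eta> e by simp
    from metric_CauchyD[OF Cm this] obtain n1
      where n1: "\<forall>i\<ge>n1. \<forall>j\<ge>n1. dist (m i) (m j) < \<eta> * e / 4" by blast
    obtain n2 where n2: "8 / (\<eta> * e) < real n2" using reals_Archimedean2[of "8 / (\<eta> * e)"] by auto
    have main: "(\<integral>x. norm (h i x - h j x) \<partial>M) < e" if ij: "i \<le> j" "max n1 n2 \<le> i" for i j
    proof -
      define q where "q = 4 / real (Suc i)"
      have q: "q < \<eta> * e / 2"
      proof -
        have "8 < real n2 * (\<eta> * e)" using n2 \<eta> e by (simp add: pos_divide_less_eq)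
        also have "\<dots> \<le> real (Suc i) * (\<eta> * e)" using ij \<eta> e by (intro mult_right_mono) auto
        finally show ?thesis unfolding q_def by (simp add: pos_divide_less_eq mult.commute)
      qed
      then have d: "(\<integral>x. (h i x - h j x)\<^sup>2 \<partial>M) < \<eta> * e"
      proof -
        have "4 * (m j - m i) < \<eta> * e" 
        proof -
          have "n1 \<le> i" "n1 \<le> j" using ij by auto
          then have "dist (m j) (m i) < \<eta> * e / 4" using n1 by blast
          then have "4 * dist (m j) (m i) < \<eta> * e" by simp
          moreover have "4 * (m j - m i) \<le> 4 * dist (m j) (m i)"
            unfolding dist_real_def by (rule mult_left_mono[OF abs_ge_self]) simp
          ultimately show ?thesis by (rule le_less_trans[rotated])
        qed
        moreover have "2 * q < \<eta> * e" using q by simp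
        ultimately show ?thesis using par[OF ij(1), folded q_def] by linarith
      qed
      have id: "(a - b)\<^sup>2 = a * a + b * b - 2 * (a * b)" for a b :: real
        by (simp add: power2_eq_square algebra_simps)
      have i2: "integrable M (\<lambda>x. (h i x - h j x)\<^sup>2)"
        unfolding id using int2[OF h(1) h(1)]
        by (intro Bochner_Integration.integrable_diff Bochner_Integration.integrable_add
              integrable_mult_right)
      have "(\<integral>x. norm (h i x - h j x) \<partial>M) \<le> (\<integral>x. ((h i x - h j x)\<^sup>2 / \<eta> + \<eta>) / 2 \<partial>M)"
      proof (rule integral_mono)
        show "integrable M (\<lambda>x. norm (h i x - h j x))" using intb[OF h(1)] by simp
        show "integrable M (\<lambda>x. ((h i x - h j x)\<^sup>2 / \<eta> + \<eta>) / 2)" using i2 by simp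
        fix x
        define d where "d = \<bar>h i x - h j x\<bar>"
        have "0 \<le> (d - \<eta>)\<^sup>2" by simp
        then have "2 * d * \<eta> \<le> d\<^sup>2 + \<eta>\<^sup>2" by (simp add: power2_eq_square algebra_simps)
        then have "d \<le> (d\<^sup>2 / \<eta> + \<eta>) / 2" using \<eta> by (simp add: field_simps power2_eq_square)
        then show "norm (h i x - h j x) \<le> ((h i x - h j x)\<^sup>2 / \<eta> + \<eta>) / 2" by (simp add: d_def)
      qed
      also have "\<dots> = ((\<integral>x. (h i x - h j x)\<^sup>2 \<partial>M) / \<eta> + \<eta> * \<mu>) / 2"
        using i2 by (simp add: \<mu>_def)
      also have "\<dots> < (e + e) / 2"
      proof -
        have "(\<integral>x. (h i x - h j x)\<^sup>2 \<partial>M) / \<eta> < e"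
          using d \<eta> by (simp add: pos_divide_less_eq mult.commute)
        moreover have "\<eta> * \<mu> \<le> e" using \<mu> e by (simp add: \<eta>_def field_simps)
        ultimately show ?thesis by simp
      qed
      finally show ?thesis by simp
    qed
    show ?thesis
    proof (intro exI[of _ "max n1 n2"] allI impI)
      fix i j assume ij: "max n1 n2 \<le> i" "max n1 n2 \<le> j"
      show "(\<integral>x. norm (h i x - h j x) \<partial>M) < e"
      proof (cases "i \<le> j")
        case False
        then have "(\<integral>x. norm (h j x - h i x) \<partial>M) < e" using main[of j i] ij by simp
        then show ?thesis by (simp add: abs_minus_commute)
      qed (use main ij in auto)
    qed
  qed
  have hint: "integrable M (h n)" for n using intb[OF h(1)] .
  obtain r where r: "strict_mono r" "AE x in M. Cauchy (\<lambda>i. h (r i) x)"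
    using cauchy_L1_AE_cauchy_subseq[of M h] hint L1 by auto
  \<comment> \<open>Truncation gives the bound also at the points where there is no convergence.\<close>
  define g where "g x = max (- K) (min K (lim (\<lambda>i. h (r i) x)))" for x
  have gm: "g \<in> borel_measurable M"
    unfolding g_def using Cmeas[OF h(1)]
    by (intro borel_measurable_max borel_measurable_min borel_measurable_const borel_measurable_lim_metric) auto
  have conv: "AE x in M. (\<lambda>i. h (r i) x) \<longlonglongrightarrow> g x"
    using r(2)
  proof eventually_elim
    case (elim x)
    then have lim: "(\<lambda>i. h (r i) x) \<longlonglongrightarrow> lim (\<lambda>i. h (r i) x)"
      by (simp add: Cauchy_convergent_iff convergent_LIMSEQ_iff)
    have "h (r n) x \<le> K" "- K \<le> h (r n) x" for n
      using Cbd[OF h(1), of "r n" x] by (simp_all add: abs_le_iff minus_le_iff)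
    then have "lim (\<lambda>i. h (r i) x) \<le> K" "- K \<le> lim (\<lambda>i. h (r i) x)"
      using LIMSEQ_le_const2[OF lim] LIMSEQ_le_const[OF lim] by blast+
    then show ?case using lim by (simp add: g_def)
  qed
  have g_lim: "(\<integral>x. g x * \<phi> x \<partial>M) = L"
    if \<phi>: "integrable M \<phi>" and L: "(\<lambda>j. \<integral>x. f j x * \<phi> x \<partial>M) \<longlonglongrightarrow> L" for \<phi> L
  proof -
    have "(\<lambda>k. \<integral>x. h k x * \<phi> x \<partial>M) \<longlonglongrightarrow> L"
    proof (rule LIMSEQ_I)
      fix e :: real assume e: "e > 0"
      then have e2: "e / 2 > 0" by simp
      from LIMSEQ_D[OF L this] obtain n0
        where n0: "\<forall>j\<ge>n0. norm ((\<integral>x. f j x * \<phi> x \<partial>M) - L) < e / 2" by blast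
      have "norm ((\<integral>x. h k x * \<phi> x \<partial>M) - L) < e" if k: "k \<ge> n0" for k
      proof -
        have near: "(\<integral>x. f j x * \<phi> x \<partial>M) \<le> L + e / 2"
          "- (\<integral>x. f j x * \<phi> x \<partial>M) \<le> - L + e / 2" if "j \<ge> k" for j
        proof -
          have "n0 \<le> j" using k that by simp
          then have "\<bar>(\<integral>x. f j x * \<phi> x \<partial>M) - L\<bar> < e / 2" using n0 by (simp only: real_norm_def)
          then show "(\<integral>x. f j x * \<phi> x \<partial>M) \<le> L + e / 2"
            "- (\<integral>x. f j x * \<phi> x \<partial>M) \<le> - L + e / 2" by argo+
        qed
        have "(\<integral>x. h k x * \<phi> x \<partial>M) \<le> L + e / 2"
          using near(1) by (intro Ctest[OF h(1) \<phi>]) blast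
        moreover have "(\<integral>x. h k x * - \<phi> x \<partial>M) \<le> - L + e / 2"
          using near(2) \<phi> by (intro Ctest[OF h(1)]) simp_all
        then have "- (\<integral>x. h k x * \<phi> x \<partial>M) \<le> - L + e / 2" by simp
        ultimately have "\<bar>(\<integral>x. h k x * \<phi> x \<partial>M) - L\<bar> \<le> e / 2" by argo
        then show ?thesis unfolding real_norm_def using e by simp
      qed
      then show "\<exists>n0. \<forall>k\<ge>n0. norm ((\<integral>x. h k x * \<phi> x \<partial>M) - L) < e"
        by blast
    qed
    then have 1: "(\<lambda>i. \<integral>x. h (r i) x * \<phi> x \<partial>M) \<longlonglongrightarrow> L"
      using LIMSEQ_subseq_LIMSEQ[OF _ r(1)] by (auto simp: o_def)
    have "(\<lambda>i. \<integral>x. h (r i) x * \<phi> x \<partial>M) \<longlonglongrightarrow> (\<integral>x. g x * \<phi> x \<partial>M)"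
    proof (rule integral_dominated_convergence)
      show "integrable M (\<lambda>x. K * \<bar>\<phi> x\<bar>)" using \<phi> by simp
      show "AE x in M. (\<lambda>i. h (r i) x * \<phi> x) \<longlonglongrightarrow> g x * \<phi> x"
        using conv by eventually_elim (intro tendsto_mult tendsto_const)
      show "AE x in M. norm (h (r i) x * \<phi> x) \<le> K * \<bar>\<phi> x\<bar>" for i
        using Cbd[OF h(1)] by (auto simp: abs_mult intro!: mult_right_mono)
      have [measurable]: "\<phi> \<in> borel_measurable M" using \<phi> by (rule borel_measurable_integrable)
      have [measurable]: "h (r i) \<in> borel_measurable M" for i by (rule Cmeas[OF h(1)])
      note gm[measurable]
      show "(\<lambda>x. g x * \<phi> x) \<in> borel_measurable M" by measurable
      show "(\<lambda>x. h (r i) x * \<phi> x) \<in> borel_measurable M" for i by measurable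
    qed
    then show ?thesis using 1 by (rule LIMSEQ_unique)
  qed
  have g_bd: "\<bar>g x\<bar> \<le> K" for x using K by (auto simp: g_def abs_le_iff)
  show ?thesis by (intro exI[of _ g] conjI allI impI gm g_bd g_lim)
qed

lemma Linf_normI:
  assumes "f \<in> borel_measurable (lebesgue_on \<Omega>)" "\<And>x. x \<in> \<Omega> \<Longrightarrow> norm (f x) \<le> c"
  shows "Linf_norm \<Omega> f \<le> ennreal c"
  unfolding Linf_norm_def
proof (rule esssup_I)
  show "(\<lambda>x. ennreal (norm (f x))) \<in> borel_measurable (lebesgue_on \<Omega>)"
    using assms(1) by measurable
  show "AE x in lebesgue_on \<Omega>. ennreal (norm (f x)) \<le> ennreal c"
    using assms(2) by (intro AE_I2) (auto intro: ennreal_leI)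
qed

text \<open>
  The set where the modulus of a continuous function exceeds \<open>c\<close> is open, so it is
  empty once it is negligible.
\<close>

lemma Linf_norm_le_imp_le:
  fixes u :: "'a::euclidean_space \<Rightarrow> real"
  assumes \<Omega>: "open \<Omega>" and u: "continuous_on \<Omega> u" and le: "Linf_norm \<Omega> u \<le> ennreal c" and c: "c \<ge> 0"
    and x: "x \<in> \<Omega>"
  shows "\<bar>u x\<bar> \<le> c"
proof (rule ccontr)
  assume neg: "\<not> \<bar>u x\<bar> \<le> c"
  define S where "S = \<Omega> \<inter> (\<lambda>x. \<bar>u x\<bar>) -` {c<..}"
  have "continuous_on \<Omega> (\<lambda>x. \<bar>u x\<bar>)" by (intro continuous_intros u)
  then have "open S" unfolding S_def by (intro continuous_open_preimage \<Omega>) auto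
  have [measurable]: "\<Omega> \<in> sets lebesgue" using \<Omega> by simp
  have "AE y in lebesgue_on \<Omega>. ennreal (norm (u y)) \<le> Linf_norm \<Omega> u"
    unfolding Linf_norm_def by (rule esssup_AE)
  then have "AE y in lebesgue_on \<Omega>. \<bar>u y\<bar> \<le> c"
  proof eventually_elim
    case (elim y)
    then have "ennreal \<bar>u y\<bar> \<le> ennreal c" using le by simp
    then show ?case using c by simp
  qed
  then have "AE y in lebesgue. y \<in> \<Omega> \<longrightarrow> \<bar>u y\<bar> \<le> c"
    using \<Omega> by (subst (asm) AE_restrict_space_iff) auto
  then have "AE y in lebesgue. y \<notin> S" by eventually_elim (auto simp: S_def)
  then have "negligible S"
    using \<open>open S\<close> by (simp add: negligible_iff_null_sets AE_iff_null_sets)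
  then have "S = {}" using open_not_negligible[OF \<open>open S\<close>] by blast
  then show False using x neg by (auto simp: S_def)
qed

lemma test_function_props:
  fixes \<phi> :: "'a::euclidean_space \<Rightarrow> real"
  assumes "test_function \<Omega> \<phi>"
  shows "\<phi> differentiable (at x)" "continuous_on UNIV \<phi>"
    "e \<in> Basis \<Longrightarrow> continuous_on UNIV (partial_deriv e \<phi>)"
    "x \<notin> \<Omega> \<Longrightarrow> \<phi> x = 0" "x \<notin> closure {x. \<phi> x \<noteq> 0} \<Longrightarrow> \<phi> x = 0"
    "x \<notin> closure {x. \<phi> x \<noteq> 0} \<Longrightarrow> partial_deriv e \<phi> x = 0"
    "x \<notin> \<Omega> \<Longrightarrow> partial_deriv e \<phi> x = 0"
proof -
  have "Ck_on 1 UNIV \<phi>" and sub: "closure {x. \<phi> x \<noteq> 0} \<subseteq> \<Omega>"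
    using assms unfolding test_function_def smooth_on_def by blast+
  then have C1: "\<forall>x. \<phi> differentiable (at x)" "\<forall>e\<in>Basis. continuous_on UNIV (partial_deriv e \<phi>)"
    unfolding One_nat_def Ck_on.simps by blast+
  have dif: "\<phi> differentiable (at x)" for x using C1(1) ..
  have pc: "continuous_on UNIV (partial_deriv e \<phi>)" if "e \<in> Basis" for e using C1(2) that ..
  show "\<phi> differentiable (at x)" by (rule dif)
  show "e \<in> Basis \<Longrightarrow> continuous_on UNIV (partial_deriv e \<phi>)" by (rule pc)
  show "continuous_on UNIV \<phi>"
    by (intro continuous_at_imp_continuous_on ballI differentiable_imp_continuous_within dif)
  have z: "\<phi> x = 0" if "x \<notin> closure {x. \<phi> x \<noteq> 0}" for x
    using subsetD[OF closure_subset, of x "{x. \<phi> x \<noteq> 0}"] that by auto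
  have p: "partial_deriv e \<phi> x = 0" if "x \<notin> closure {x. \<phi> x \<noteq> 0}" for x
  proof -
    have "partial_deriv e \<phi> x = partial_deriv e (\<lambda>_. 0 :: real) x"
    proof (rule partial_deriv_cong_open[OF open_Compl[OF closed_closure]])
      show "x \<in> - closure {x. \<phi> x \<noteq> 0}" using that unfolding Compl_iff .
      show "\<phi> y = 0" if "y \<in> - closure {x. \<phi> x \<noteq> 0}" for y using that unfolding Compl_iff by (rule z)
    qed
    also have "\<dots> = 0" using partial_deriv_eq[OF has_derivative_const] .
    finally show ?thesis .
  qed
  show "x \<notin> closure {x. \<phi> x \<noteq> 0} \<Longrightarrow> \<phi> x = 0"
    "x \<notin> closure {x. \<phi> x \<noteq> 0} \<Longrightarrow> partial_deriv e \<phi> x = 0"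
    by (fact z, fact p)
  show "x \<notin> \<Omega> \<Longrightarrow> \<phi> x = 0" "x \<notin> \<Omega> \<Longrightarrow> partial_deriv e \<phi> x = 0"
    using z[of x] p[of x] subsetD[OF sub, of x] by blast+
qed

lemma integrable_continuous_bounded_support:
  fixes G :: "'a::euclidean_space \<Rightarrow> real"
  assumes "continuous_on UNIV G" "\<And>x. norm x > R \<Longrightarrow> G x = 0"
  shows "integrable lborel G"
proof -
  have "integrable lborel (\<lambda>x. indicator (cball 0 R) x *\<^sub>R G x)"
    by (rule borel_integrable_compact[OF compact_cball continuous_on_subset[OF assms(1)]]) simp
  also have "(\<lambda>x. indicator (cball 0 R) x *\<^sub>R G x) = G"
    using assms(2) by (auto simp: indicator_def fun_eq_iff)
  finally show ?thesis .
qed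

lemma integral_lebesgue_on_eq_lborel:
  fixes G :: "'a::euclidean_space \<Rightarrow> real"
  assumes "open \<Omega>" "continuous_on UNIV G" "\<And>x. x \<notin> \<Omega> \<Longrightarrow> G x = 0"
  shows "integral\<^sup>L (lebesgue_on \<Omega>) G = integral\<^sup>L lborel G"
    "integrable lborel G \<Longrightarrow> integrable (lebesgue_on \<Omega>) G"
proof -
  have ind: "(\<lambda>x. indicator \<Omega> x *\<^sub>R G x) = G"
    using assms(3) by (auto simp: indicator_def fun_eq_iff)
  have m: "G \<in> borel_measurable lborel"
    using borel_measurable_continuous_onI[OF assms(2)] by simp
  have s: "\<Omega> \<inter> space lebesgue \<in> sets lebesgue" using assms(1) by simp
  show "integral\<^sup>L (lebesgue_on \<Omega>) G = integral\<^sup>L lborel G"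
    unfolding integral_restrict_space[OF s] ind by (rule integral_completion[OF m])
  show "integrable (lebesgue_on \<Omega>) G" if "integrable lborel G"
    unfolding integrable_restrict_space[OF s] ind using that by (simp add: integrable_completion[OF m])
qed

lemma integral_lborel_translate:
  fixes G :: "'a::euclidean_space \<Rightarrow> real"
  assumes "continuous_on UNIV G"
  shows "(\<integral>x. G (x + c) \<partial>lborel) = (\<integral>x. G x \<partial>lborel)"
proof -
  have m: "G \<in> borel_measurable borel"
    using borel_measurable_continuous_onI[OF assms] by simp
  have "(\<integral>x. G x \<partial>lborel) = (\<integral>x. G x \<partial>(distr lborel borel ((+) c)))"
    by (simp add: lborel_distr_plus)
  also have "\<dots> = (\<integral>x. G (c + x) \<partial>lborel)"
    by (rule integral_distr) (use m in auto)
  finally show ?thesis by (simp add: add.commute)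
qed

text \<open>
  Discrete integration by parts moves a difference quotient from \<open>V\<close> to the test
  function, where it converges by dominated convergence. The quotients of \<open>V\<close> are
  bounded by \<open>L\<close> and so have a weak limit \<open>g\<close>, which is the weak
  derivative.
\<close>

lemma lipschitz_weak_partial_derivative:
  fixes V :: "'a::euclidean_space \<Rightarrow> real"
  assumes \<Omega>: "open \<Omega>" "bounded \<Omega>" and e: "e \<in> Basis"
    and lip: "\<And>x y. \<bar>V x - V y\<bar> \<le> L * dist x y"
  shows "\<exists>g. g \<in> borel_measurable (lebesgue_on \<Omega>) \<and> (\<forall>x. \<bar>g x\<bar> \<le> L) \<and>
    (\<forall>\<phi>. test_function \<Omega> \<phi> \<longrightarrow>
      (LINT x|lebesgue_on \<Omega>. V x * partial_deriv e \<phi> x) = - (LINT x|lebesgue_on \<Omega>. g x * \<phi> x))"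
proof -
  have normalised: "norm e = 1" using e by simp
  have "L-lipschitz_on UNIV V"
    using lip order_trans[OF abs_ge_zero lip[of 0 e]] normalised by (intro lipschitz_onI) (auto simp: dist_real_def)
  then have Vc: "continuous_on UNIV V" by (rule lipschitz_on_continuous_on)
  define c where "c j = inverse (real (Suc j))" for j
  have c: "0 < c j" "c j \<le> 1" for j by (auto simp: c_def inverse_le_1_iff)
  define f where "f j x = (V (x + c j *\<^sub>R e) - V x) / c j" for j x
  have fbd: "\<bar>f j x\<bar> \<le> L" for j x
  proof -
    have "\<bar>V (x + c j *\<^sub>R e) - V x\<bar> \<le> L * c j"
      using lip[of "x + c j *\<^sub>R e" x] normalised c(1)[of j] by (simp add: dist_norm)
    then show ?thesis using c(1)[of j] by (simp add: f_def abs_divide pos_divide_le_eq)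
  qed
  have fc: "continuous_on UNIV (f j)" for j
    unfolding f_def divide_inverse by (intro continuous_intros continuous_on_compose2[OF Vc]) auto
  have fm: "f j \<in> borel_measurable (lebesgue_on \<Omega>)" for j
    by (intro continuous_imp_measurable_on_sets_lebesgue continuous_on_subset[OF fc]) (use \<Omega> in auto)
  have fin: "finite_measure (lebesgue_on \<Omega>)"
    by (intro finite_measure_lebesgue_on lmeasurable_open \<Omega>)
  from bounded_weak_limit[OF fin fm fbd] obtain g
    where g_all: "g \<in> borel_measurable (lebesgue_on \<Omega>) \<and> (\<forall>x. \<bar>g x\<bar> \<le> L) \<and>
      (\<forall>\<phi> A. integrable (lebesgue_on \<Omega>) \<phi> \<longrightarrow>
        (\<lambda>j. LINT x|lebesgue_on \<Omega>. f j x * \<phi> x) \<longlonglongrightarrow> A \<longrightarrow> (LINT x|lebesgue_on \<Omega>. g x * \<phi> x) = A)" ..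
  note g = g_all[THEN conjunct1] g_all[THEN conjunct2, THEN conjunct1]
  have lim: "(LINT x|lebesgue_on \<Omega>. g x * \<phi> x) = A"
    if "integrable (lebesgue_on \<Omega>) \<phi>" "(\<lambda>j. LINT x|lebesgue_on \<Omega>. f j x * \<phi> x) \<longlonglongrightarrow> A" for \<phi> A
    using g_all[THEN conjunct2, THEN conjunct2] that by iprover
  have "(LINT x|lebesgue_on \<Omega>. V x * partial_deriv e \<phi> x) = - (LINT x|lebesgue_on \<Omega>. g x * \<phi> x)"
    if \<phi>: "test_function \<Omega> \<phi>" for \<phi>
  proof -
    note tf = test_function_props[OF \<phi>]
    define P where "P = partial_deriv e \<phi>"
    have Pc: "continuous_on UNIV P" unfolding P_def by (rule tf(3)[OF e])
    have "bounded (closure {x. \<phi> x \<noteq> 0})"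
      using \<phi> by (simp add: test_function_def compact_imp_bounded)
    then obtain R where R: "\<forall>x\<in>closure {x. \<phi> x \<noteq> 0}. norm x \<le> R" unfolding bounded_iff by blast
    have "x \<notin> closure {x. \<phi> x \<noteq> 0}" if "norm x > R" for x
      using R that linorder_not_less by blast
    then have \<phi>0: "\<phi> x = 0" and P0: "P x = 0" if "norm x > R" for x
      unfolding P_def using that by (intro tf(5), blast, intro tf(6), blast)
    have "bounded (P ` cball 0 R)"
      by (intro compact_imp_bounded compact_continuous_image continuous_on_subset[OF Pc]) auto
    then obtain B0 where B0: "\<forall>x\<in>cball 0 R. \<bar>P x\<bar> \<le> B0" unfolding bounded_iff by auto
    define B where "B = \<bar>B0\<bar>"
    have B: "\<bar>P x\<bar> \<le> B" for x
    proof (cases "norm x \<le> R")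
      case True
      then have "\<bar>P x\<bar> \<le> B0" using B0 by simp
      then show ?thesis by (simp add: B_def)
    qed (use P0[of x] in \<open>simp add: B_def\<close>)
    have line: "((\<lambda>t. \<phi> (x - t *\<^sub>R e)) has_real_derivative - P (x - t *\<^sub>R e)) (at t)" for x t
    proof -
      define F where "F = frechet_derivative \<phi> (at (x - t *\<^sub>R e))"
      have F: "(\<phi> has_derivative F) (at (x - t *\<^sub>R e))"
        unfolding F_def using tf(1) by (simp add: frechet_derivative_works)
      then have lin: "linear F" by (rule has_derivative_linear)
      have "((\<lambda>t. x - t *\<^sub>R e) has_derivative (\<lambda>h. - (h *\<^sub>R e))) (at t)"
        by (auto intro!: derivative_eq_intros)
      from has_derivative_compose[OF this F]
      have "((\<lambda>t. \<phi> (x - t *\<^sub>R e)) has_derivative (\<lambda>h. F (- (h *\<^sub>R e)))) (at t)" .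
      moreover have "P (x - t *\<^sub>R e) = F e" by (simp add: P_def partial_deriv_def F_def)
      then have "F (- (h *\<^sub>R e)) = - P (x - t *\<^sub>R e) * h" for h
        by (simp add: linear_neg[OF lin] linear_scale[OF lin])
      then have "(\<lambda>h. F (- (h *\<^sub>R e))) = (*) (- P (x - t *\<^sub>R e))" by (rule ext)
      ultimately show ?thesis by (simp add: has_field_derivative_def)
    qed
    define q where "q j x = (\<phi> x - \<phi> (x - c j *\<^sub>R e)) / c j" for j x
    have qbd: "\<bar>q j x\<bar> \<le> B" for j x
    proof -
      have "\<exists>z. z > 0 \<and> z < c j \<and>
          \<phi> (x - c j *\<^sub>R e) - \<phi> (x - 0 *\<^sub>R e) = (c j - 0) * - P (x - z *\<^sub>R e)"
        using MVT2[of 0 "c j" "\<lambda>t. \<phi> (x - t *\<^sub>R e)" "\<lambda>t. - P (x - t *\<^sub>R e)", OF c(1) line] .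
      then obtain z where "\<phi> (x - c j *\<^sub>R e) - \<phi> (x - 0 *\<^sub>R e) = (c j - 0) * - P (x - z *\<^sub>R e)"
        by blast
      then have "\<phi> (x - c j *\<^sub>R e) - \<phi> x = - (c j * P (x - z *\<^sub>R e))" by simp
      then have eq: "\<phi> x - \<phi> (x - c j *\<^sub>R e) = P (x - z *\<^sub>R e) * c j" by argo
      have "q j x = P (x - z *\<^sub>R e)"
        unfolding q_def eq using c(1)[of j] by (intro nonzero_mult_div_cancel_right) simp
      then show ?thesis using B by simp
    qed
    have "(\<lambda>j. c j) \<longlonglongrightarrow> 0" unfolding c_def by (rule LIMSEQ_inverse_real_of_nat)
    then have c_at: "filterlim c (at 0) sequentially"
      using c(1) by (intro filterlim_atI always_eventually allI) (simp_all add: less_imp_neq[symmetric])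
    have qlim: "(\<lambda>j. q j x) \<longlonglongrightarrow> P x" for x
    proof -
      have "((\<lambda>h. (\<phi> (x - (0 + h) *\<^sub>R e) - \<phi> (x - 0 *\<^sub>R e)) / h) \<longlongrightarrow> - P (x - 0 *\<^sub>R e)) (at 0)"
        using line[of x 0] by (simp only: DERIV_def)
      from tendsto_minus[OF filterlim_compose[OF this c_at]]
      show ?thesis by (simp add: q_def minus_divide_left)
    qed
    have shiftc: "continuous_on UNIV (\<lambda>x. \<phi> (x - c j *\<^sub>R e))" for j
      by (intro continuous_on_compose2[OF tf(2)] continuous_intros) auto
    have shift0: "\<phi> (x - c j *\<^sub>R e) = 0" if "norm x > R + 1" for x j
    proof -
      have "norm x \<le> norm (x - c j *\<^sub>R e) + norm (c j *\<^sub>R e)" using norm_triangle_sub by (metis add.commute)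
      then have "norm (x - c j *\<^sub>R e) > R" using that c[of j] normalised by simp
      then show ?thesis by (rule \<phi>0)
    qed
    have int1: "integrable lborel (\<lambda>x. V x * \<phi> (x - c j *\<^sub>R e))" for j
      by (rule integrable_continuous_bounded_support[of _ "R + 1"])
         (use shift0 in \<open>auto intro!: continuous_on_mult Vc shiftc\<close>)
    have int2: "integrable lborel (\<lambda>x. V x * \<phi> x)"
      by (rule integrable_continuous_bounded_support[of _ R])
         (use \<phi>0 in \<open>auto intro!: continuous_on_mult Vc tf(2)\<close>)
    have c1: "continuous_on UNIV (\<lambda>x. V (x + c j *\<^sub>R e) * \<phi> x)" for j
      by (intro continuous_on_mult tf(2) continuous_on_compose2[OF Vc] continuous_intros) auto
    have int3: "integrable lborel (\<lambda>x. V (x + c j *\<^sub>R e) * \<phi> x)" for j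
      by (rule integrable_continuous_bounded_support[of _ R, OF c1]) (use \<phi>0 in auto)
    have parts: "(LINT x|lebesgue_on \<Omega>. f j x * \<phi> x) = (\<integral>x. - (V x * q j x) \<partial>lborel)" for j
    proof -
      have "(LINT x|lebesgue_on \<Omega>. f j x * \<phi> x) = (\<integral>x. f j x * \<phi> x \<partial>lborel)"
        by (intro integral_lebesgue_on_eq_lborel \<Omega> continuous_on_mult fc tf(2)) (use tf(4) in auto)
      also have "\<dots> = (\<integral>x. (V (x + c j *\<^sub>R e) * \<phi> x - V x * \<phi> x) / c j \<partial>lborel)"
        by (simp add: f_def left_diff_distrib)
      also have "\<dots> = ((\<integral>x. V (x + c j *\<^sub>R e) * \<phi> x \<partial>lborel) - (\<integral>x. V x * \<phi> x \<partial>lborel)) / c j"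
        using int2 int3 by simp
      also have "(\<integral>x. V (x + c j *\<^sub>R e) * \<phi> x \<partial>lborel) = (\<integral>x. V x * \<phi> (x - c j *\<^sub>R e) \<partial>lborel)"
        using integral_lborel_translate[OF continuous_on_mult[OF Vc shiftc], of "c j *\<^sub>R e" j] by simp
      also have "((\<integral>x. V x * \<phi> (x - c j *\<^sub>R e) \<partial>lborel) - (\<integral>x. V x * \<phi> x \<partial>lborel)) / c j
          = (\<integral>x. (V x * \<phi> (x - c j *\<^sub>R e) - V x * \<phi> x) / c j \<partial>lborel)"
        using int1 int2 by simp
      also have "\<dots> = (\<integral>x. - (V x * q j x) \<partial>lborel)"
        by (rule Bochner_Integration.integral_cong) (simp_all add: q_def diff_divide_distrib algebra_simps)
      finally show ?thesis .
    qed
    define w where "w x = indicator (cball 0 (R + 1)) x *\<^sub>R (\<bar>V x\<bar> * B)" for x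
    have "(\<lambda>j. \<integral>x. - (V x * q j x) \<partial>lborel) \<longlonglongrightarrow> (\<integral>x. - (V x * P x) \<partial>lborel)"
    proof (rule integral_dominated_convergence[of _ _ _ w])
      show "integrable lborel w"
        unfolding w_def
        by (intro borel_integrable_compact compact_cball continuous_intros continuous_on_subset[OF Vc]) auto
      have "continuous_on UNIV (\<lambda>x. - (V x * P x))" by (intro continuous_intros Vc Pc)
      then show "(\<lambda>x. - (V x * P x)) \<in> borel_measurable lborel"
        using borel_measurable_continuous_onI by fastforce
      have "continuous_on UNIV (\<lambda>x. - (V x * q j x))" for j
        unfolding q_def divide_inverse by (intro continuous_intros Vc shiftc tf(2))
      then show "(\<lambda>x. - (V x * q j x)) \<in> borel_measurable lborel" for j
        using borel_measurable_continuous_onI by fastforce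
      show "AE x in lborel. (\<lambda>j. - (V x * q j x)) \<longlonglongrightarrow> - (V x * P x)"
        by (intro AE_I2 tendsto_minus tendsto_mult tendsto_const qlim)
      show "AE x in lborel. norm (- (V x * q j x)) \<le> w x" for j
      proof (intro AE_I2)
        fix x
        show "norm (- (V x * q j x)) \<le> w x"
        proof (cases "norm x \<le> R + 1")
          case True
          then show ?thesis using qbd[of j x] by (simp add: w_def abs_mult mult_left_mono)
        next
          case False
          then have "q j x = 0" using shift0[of x j] \<phi>0[of x] by (simp add: q_def)
          then show ?thesis using False by (simp add: w_def)
        qed
      qed
    qed
    then have "(\<lambda>j. LINT x|lebesgue_on \<Omega>. f j x * \<phi> x) \<longlonglongrightarrow> (\<integral>x. - (V x * P x) \<partial>lborel)"
      unfolding parts .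
    moreover have "integrable (lebesgue_on \<Omega>) \<phi>"
      by (intro integral_lebesgue_on_eq_lborel(2) \<Omega> tf integrable_continuous_bounded_support[of _ R] \<phi>0) auto
    ultimately have "(LINT x|lebesgue_on \<Omega>. g x * \<phi> x) = (\<integral>x. - (V x * P x) \<partial>lborel)"
      by (rule lim[rotated])
    moreover have "(LINT x|lebesgue_on \<Omega>. V x * P x) = (\<integral>x. V x * P x \<partial>lborel)"
      by (intro integral_lebesgue_on_eq_lborel \<Omega> continuous_on_mult Vc Pc) (use tf(7) in \<open>auto simp: P_def\<close>)
    ultimately show ?thesis by (simp add: P_def)
  qed
  then show ?thesis using g by (intro exI[of _ g] conjI) iprover+
qed

lemma lipschitz_W1inf:
  fixes V :: "'a::euclidean_space \<Rightarrow> real"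
  assumes \<Omega>: "open \<Omega>" "bounded \<Omega>" and lip: "\<And>x y. \<bar>V x - V y\<bar> \<le> L * dist x y"
  shows "W1inf \<Omega> V"
proof -
  have "\<forall>i\<in>Basis. \<exists>g. g \<in> borel_measurable (lebesgue_on \<Omega>) \<and> (\<forall>x. \<bar>g x\<bar> \<le> L) \<and>
    (\<forall>\<phi>. test_function \<Omega> \<phi> \<longrightarrow>
      (LINT x|lebesgue_on \<Omega>. V x * partial_deriv i \<phi> x) = - (LINT x|lebesgue_on \<Omega>. g x * \<phi> x))"
    by (intro ballI lipschitz_weak_partial_derivative[OF \<Omega> _ lip])
  from bchoice[OF this] obtain G where G:
    "\<forall>i\<in>Basis. G i \<in> borel_measurable (lebesgue_on \<Omega>) \<and> (\<forall>x. \<bar>G i x\<bar> \<le> L) \<and>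
    (\<forall>\<phi>. test_function \<Omega> \<phi> \<longrightarrow>
      (LINT x|lebesgue_on \<Omega>. V x * partial_deriv i \<phi> x) = - (LINT x|lebesgue_on \<Omega>. G i x * \<phi> x))" ..
  define g where "g x = (\<Sum>i\<in>Basis. G i x *\<^sub>R i)" for x
  have gi: "g x \<bullet> i = G i x" if "i \<in> Basis" for x i
    using that by (simp add: g_def inner_sum_left_Basis)
  have gm: "g \<in> borel_measurable (lebesgue_on \<Omega>)"
    unfolding g_def using G by (intro borel_measurable_sum borel_measurable_scaleR borel_measurable_const) auto
  have "norm (g x) \<le> (\<Sum>i\<in>(Basis::'a set). L)" for x
    unfolding g_def
  proof (rule order_trans[OF norm_sum sum_mono])
    fix i :: 'a assume "i \<in> Basis"
    then show "norm (G i x *\<^sub>R i) \<le> L" using G by simp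
  qed
  then have "Linf_norm \<Omega> g \<le> ennreal (\<Sum>i\<in>(Basis::'a set). L)" by (intro Linf_normI gm)
  then have "Linf \<Omega> g"
    using gm le_less_trans[OF _ ennreal_less_top] by (simp add: Linf_def)
  moreover have "weak_grad \<Omega> V g"
    using G by (simp add: weak_grad_def gi)
  moreover have "Linf \<Omega> V"
  proof -
    obtain i :: 'a where "i \<in> Basis" using nonempty_Basis by blast
    then have "L \<ge> 0" using order_trans[OF abs_ge_zero lip[of 0 i]] by simp
    then have "L-lipschitz_on UNIV V" using lip by (intro lipschitz_onI) (auto simp: dist_real_def)
    then have Vc: "continuous_on UNIV V" by (rule lipschitz_on_continuous_on)
    have Vm: "V \<in> borel_measurable (lebesgue_on \<Omega>)"
      by (intro continuous_imp_measurable_on_sets_lebesgue continuous_on_subset[OF Vc]) (use \<Omega> in auto)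
    obtain B where "\<And>x. x \<in> \<Omega> \<Longrightarrow> \<bar>V x\<bar> \<le> B"
      using continuous_imp_bounded_on_bounded[OF \<Omega>(2) Vc] by blast
    then have "Linf_norm \<Omega> V \<le> ennreal B" using Vm by (intro Linf_normI) auto
    then show ?thesis using Vm le_less_trans[OF _ ennreal_less_top] by (simp add: Linf_def)
  qed
  ultimately show ?thesis unfolding W1inf_def by iprover
qed

section \<open>The limit of the solutions\<close>

text \<open>
  Finitely many balls whose radius is small compared with the Lipschitz constant cover
  \<open>K\<close>; convergence at their centres controls everything else.
\<close>

lemma equilipschitz_limit_uniform:
  fixes V :: "'a::euclidean_space \<Rightarrow> real"
  assumes K: "compact K" and L: "L \<ge> 0"
    and lim: "\<And>x. x \<in> K \<Longrightarrow> (\<lambda>n. f n x) \<longlonglongrightarrow> V x"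
    and lip: "\<And>n x y. x \<in> K \<Longrightarrow> y \<in> K \<Longrightarrow> \<bar>f n x - f n y\<bar> \<le> L * dist x y"
    and lipV: "\<And>x y. x \<in> K \<Longrightarrow> y \<in> K \<Longrightarrow> \<bar>V x - V y\<bar> \<le> L * dist x y"
  shows "uniform_limit K f V sequentially"
proof (rule uniform_limitI)
  fix e :: real assume e: "e > 0"
  define d where "d = (e / 3) / (L + 1)"
  have d: "d > 0" using e L by (simp add: d_def)
  have Ld: "3 * (L * d) \<le> e"
  proof -
    have "L * d \<le> (L + 1) * d" using d by simp
    also have "(L + 1) * d = d * (L + 1)" by (rule mult.commute)
    also have "\<dots> = e / 3"
      unfolding d_def using L by (intro nonzero_eq_divide_eq[THEN iffD1] refl) simp
    finally show ?thesis by simp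
  qed
  obtain T where T: "T \<subseteq> K" "finite T" "K \<subseteq> (\<Union>c\<in>T. ball c d)"
  proof (rule compactE_image[OF K, of K "\<lambda>c. ball c d"])
    show "open (ball c d)" for c by simp
    show "K \<subseteq> (\<Union>c\<in>K. ball c d)" using d by auto
  qed (rule that)
  have "\<forall>\<^sub>F n in sequentially. \<forall>c\<in>T. dist (f n c) (V c) < e / 3"
    using T(1) e by (intro eventually_ball_finite T(2) ballI tendstoD[OF lim]) auto
  then show "\<forall>\<^sub>F n in sequentially. \<forall>x\<in>K. dist (f n x) (V x) < e"
  proof eventually_elim
    case (elim n)
    show ?case
    proof
      fix x assume x: "x \<in> K"
      then obtain c where c: "c \<in> T" "dist c x < d" using T(3) by auto
      have cK: "c \<in> K" using c(1) T(1) by blast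
      have "L * dist c x \<le> L * d" using c(2) L by (intro mult_left_mono) auto
      moreover have "\<bar>f n x - f n c\<bar> \<le> L * dist c x" "\<bar>V c - V x\<bar> \<le> L * dist c x"
        using lip[OF x cK, of n] lipV[OF cK x] by (simp_all add: dist_commute)
      moreover have "\<bar>f n c - V c\<bar> < e / 3" using elim c(1) by (simp add: dist_real_def)
      ultimately show "dist (f n x) (V x) < e" using Ld unfolding dist_real_def by argo
    qed
  qed
qed

lemma dirichlet_solution_bounds:
  fixes u :: "'a::euclidean_space \<Rightarrow> real"
  assumes \<Omega>: "open \<Omega>" and u: "dirichlet_solution \<Omega> l u" and norm: "Linf_norm \<Omega> u = 1"
  shows "x \<in> \<Omega> \<Longrightarrow> u x \<le> 1" and "c < 1 \<Longrightarrow> 0 \<le> c \<Longrightarrow> \<exists>x\<in>\<Omega>. c < u x"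
proof -
  have uc: "continuous_on \<Omega> u" and nn: "\<forall>y\<in>\<Omega>. 0 \<le> u y"
    using u unfolding dirichlet_solution_def viscosity_solution_def by blast+
  show "u x \<le> 1" if "x \<in> \<Omega>"
    using Linf_norm_le_imp_le[OF \<Omega> uc _ _ that, of 1] norm by simp
  have m: "u \<in> borel_measurable (lebesgue_on \<Omega>)"
    using uc \<Omega> by (intro continuous_imp_measurable_on_sets_lebesgue) auto
  show "\<exists>x\<in>\<Omega>. c < u x" if c: "c < 1" "0 \<le> c"
  proof (rule ccontr)
    assume "\<not> (\<exists>x\<in>\<Omega>. c < u x)"
    then have "norm (u y) \<le> c" if "y \<in> \<Omega>" for y using nn that by (simp add: not_less)
    from Linf_normI[OF m this] have "1 \<le> ennreal c" using norm by simp
    then show False using c by (simp add: ennreal_ge_1)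
  qed
qed

theorem theorem1p3:
  fixes \<Omega> :: "(real ^ 'n) set" and v :: "real \<Rightarrow> real ^ 'n \<Rightarrow> real"
  assumes "open \<Omega>" and "connected \<Omega>" and "bounded \<Omega>" and "smooth_boundary \<Omega>"
    and "\<And>l. 0 < l \<Longrightarrow> l < 1 \<Longrightarrow> dirichlet_solution \<Omega> l (v l)"
    and "\<And>l. 0 < l \<Longrightarrow> l < 1 \<Longrightarrow> Linf_norm \<Omega> (v l) = 1"
  shows "\<exists>vhat. W1inf0 \<Omega> vhat \<and> continuous_on (closure \<Omega>) vhat \<and>
           uniform_limit (closure \<Omega>) v vhat (at_left 1) \<and>
           dirichlet_solution \<Omega> 1 vhat \<and> Linf_norm \<Omega> vhat = 1 \<and>
           (\<forall>u. dirichlet_solution \<Omega> 1 u \<and> Linf_norm \<Omega> u = 1 \<longrightarrow>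
                (\<forall>x\<in>closure \<Omega>. u x \<le> vhat x))"
proof -
  note \<Omega> = assms(1,3)
  define \<Lambda> where "\<Lambda> = lambda_1_inf \<Omega>"
  have v: "dirichlet_solution \<Omega> l (v l)" and v1: "x \<in> \<Omega> \<Longrightarrow> v l x \<le> 1"
    and vbig: "c < 1 \<Longrightarrow> 0 \<le> c \<Longrightarrow> \<exists>x\<in>\<Omega>. c < v l x" if "0 < l" "l < 1" for l x c
    using assms(5)[OF that] dirichlet_solution_bounds[OF \<Omega>(1) assms(5)[OF that] assms(6)[OF that]]
    by blast+
  have vis: "viscosity_solution \<Omega> l (v l)" and vfr: "x \<in> frontier \<Omega> \<Longrightarrow> v l x = 0"
    if "0 < l" "l < 1" for l x
    using v[OF that] unfolding dirichlet_solution_def by blast+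
  have vpos: "0 < v l x" if l: "0 < l" "l < 1" and x: "x \<in> \<Omega>" for l x
  proof -
    obtain x1 where "x1 \<in> \<Omega>" "0 < v l x1" using vbig[OF l, of 0] by auto
    then show ?thesis by (rule supersolution_positive[OF \<Omega> assms(2) vis[OF l] _ _ x])
  qed
  have \<Lambda>: "\<Lambda> > 0"
  proof -
    have half: "0 < (1/2 :: real)" "(1/2 :: real) < 1" by simp_all
    obtain x1 where x1: "x1 \<in> \<Omega>" "0 < v (1/2) x1" using vbig[OF half, of 0] by auto
    show ?thesis
      unfolding \<Lambda>_def
      by (rule subsolution_positive_imp_lambda_pos[OF \<Omega> v[OF half] _ x1]) (rule v1[OF half])
  qed
  have lip: "\<bar>v l x - v l y\<bar> \<le> \<Lambda> * dist x y"
    if "0 < l" "l < 1" "x \<in> closure \<Omega>" "y \<in> closure \<Omega>" for l x y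
    unfolding \<Lambda>_def
    by (rule subsolution_lipschitz[OF \<Omega> \<Lambda>[unfolded \<Lambda>_def] _ v v1]) (use that in auto)
  have mono: "v m x \<le> v l x" if "0 < l" "l \<le> m" "m < 1" "x \<in> closure \<Omega>" for l m x
    by (rule comparison[OF \<Omega> \<Lambda>[unfolded \<Lambda>_def] v v1 v vpos]) (use that in auto)

  \<comment> \<open>A sequence in \<open>(0, 1)\<close> increasing to \<open>1\<close>; monotonicity in \<open>l\<close> later fills in the other exponents.\<close>
  define s where "s n = 1 - 1 / real (n + 2)" for n :: nat
  have s: "0 < s n" "s n < 1" for n by (simp_all add: s_def)
  have s_mono: "s i \<le> s j" if "i \<le> j" for i j using that by (simp add: s_def frac_le)
  have s_lim: "s \<longlonglongrightarrow> 1"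
  proof -
    have "(\<lambda>n. 1 - 1 / real (n + 2)) \<longlonglongrightarrow> 1 - 0"
      by (intro tendsto_diff tendsto_const LIMSEQ_ignore_initial_segment[OF lim_1_over_n])
    then show ?thesis unfolding s_def[abs_def] diff_zero .
  qed
  define V where "V x = (if x \<in> \<Omega> then lim (\<lambda>n. v (s n) x) else 0)" for x
  have ptw: "(\<lambda>n. v (s n) x) \<longlonglongrightarrow> V x" if x: "x \<in> closure \<Omega>" for x
    using mem_closure_cases[OF \<Omega>(1) x]
  proof
    assume x\<Omega>: "x \<in> \<Omega>"
    have "decseq (\<lambda>n. v (s n) x)" using mono s s_mono x by (simp add: decseq_def)
    moreover have "\<forall>n. 0 \<le> v (s n) x" using vpos[OF s x\<Omega>] by (simp add: less_imp_le)
    ultimately obtain b where "(\<lambda>n. v (s n) x) \<longlonglongrightarrow> b" by (rule decseq_convergent)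
    then show ?thesis using x\<Omega> limI by (auto simp: V_def)
  next
    assume fr: "x \<in> frontier \<Omega>"
    then have "x \<notin> \<Omega>" using \<Omega>(1) by (simp add: frontier_def interior_open)
    then show ?thesis using vfr[OF s fr] by (simp add: V_def)
  qed
  have le_V: "V x \<le> v l x" if l: "0 < l" "l < 1" and x: "x \<in> closure \<Omega>" for l x
  proof (rule LIMSEQ_le_const2[OF ptw[OF x]])
    have "\<forall>\<^sub>F n in sequentially. l < s n" by (rule order_tendstoD(1)[OF s_lim l(2)])
    then obtain N where "\<forall>n\<ge>N. l < s n" unfolding eventually_sequentially ..
    then show "\<exists>N. \<forall>n\<ge>N. v (s n) x \<le> v l x" using mono[OF l(1) _ s(2) x] by (meson less_imp_le)
  qed
  have lipV: "\<bar>V x - V y\<bar> \<le> \<Lambda> * dist x y" if "x \<in> closure \<Omega>" "y \<in> closure \<Omega>" for x y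
    by (rule LIMSEQ_le_const2[OF tendsto_rabs[OF tendsto_diff[OF ptw ptw]]])
       (use that lip[OF s] in auto)
  have V0: "V x = 0" if "x \<notin> \<Omega>" for x using that by (simp add: V_def)
  have glip: "\<bar>V x - V y\<bar> \<le> \<Lambda> * dist x y" for x y
    by (rule lipschitz_zero_extension[OF \<Omega>(1) lipV _ V0]) (use \<Lambda> in auto)
  then have "\<Lambda>-lipschitz_on UNIV V" using \<Lambda> by (intro lipschitz_onI) (auto simp: dist_real_def)
  then have "continuous_on UNIV V" by (rule lipschitz_on_continuous_on)
  then have Vc: "continuous_on (closure \<Omega>) V" by (rule continuous_on_subset) simp
  have Vfr: "V x = 0" if "x \<in> frontier \<Omega>" for x
    using V0 that \<Omega>(1) by (simp add: frontier_def interior_open)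

  have seq: "uniform_limit (closure \<Omega>) (\<lambda>n. v (s n)) V sequentially"
    by (rule equilipschitz_limit_uniform[OF _ _ ptw lip[OF s] lipV]) (use \<Omega> \<Lambda> in auto)
  have unif: "uniform_limit (closure \<Omega>) v V (at_left 1)"
  proof (rule uniform_limitI)
    fix e :: real assume "e > 0"
    from uniform_limitD[OF seq this] obtain N
      where N: "\<forall>x\<in>closure \<Omega>. dist (v (s N) x) (V x) < e" unfolding eventually_sequentially by blast
    have near: "\<forall>x\<in>closure \<Omega>. dist (v l x) (V x) < e" if l: "s N < l" "l < 1" for l
    proof
      fix x assume x: "x \<in> closure \<Omega>"
      have "0 < l" using l(1) s(1)[of N] by linarith
      then have "V x \<le> v l x" "v l x \<le> v (s N) x"
        using le_V[OF _ l(2) x] mono[OF s(1) _ l(2) x] l(1) by auto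
      moreover have "\<bar>v (s N) x - V x\<bar> < e" using N x by (simp add: dist_real_def)
      ultimately show "dist (v l x) (V x) < e" unfolding dist_real_def by argo
    qed
    show "\<forall>\<^sub>F l in at_left 1. \<forall>x\<in>closure \<Omega>. dist (v l x) (V x) < e"
      by (rule eventually_at_leftI[OF near s(2)[of N]]) simp_all
  qed

  have seq\<Omega>: "uniform_limit \<Omega> (\<lambda>n. v (s n)) V sequentially"
    by (rule uniform_limit_on_subset[OF seq closure_subset])
  have "viscosity_solution \<Omega> 1 V"
    by (rule viscosity_solution_stable[OF \<Omega>(1) vis[OF s] s_lim _ seq\<Omega>]) simp
  then have dir: "dirichlet_solution \<Omega> 1 V" using Vc Vfr by (simp add: dirichlet_solution_def)

  have Vm: "V \<in> borel_measurable (lebesgue_on \<Omega>)"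
    using continuous_on_subset[OF Vc closure_subset] \<Omega>(1)
    by (intro continuous_imp_measurable_on_sets_lebesgue) auto
  have V\<Omega>: "0 \<le> V x" "V x \<le> 1" if "x \<in> \<Omega>" for x
  proof -
    have "x \<in> closure \<Omega>" using that by (rule subsetD[OF closure_subset])
    then show "V x \<le> 1" using le_V[OF s, of x 0] v1[OF s that, of 0] by linarith
    show "0 \<le> V x" using dir that unfolding dirichlet_solution_def viscosity_solution_def by blast
  qed
  have Vnorm: "Linf_norm \<Omega> V = 1"
  proof (rule antisym)
    show "Linf_norm \<Omega> V \<le> 1" using Linf_normI[OF Vm, of 1] V\<Omega> by simp
    show "1 \<le> Linf_norm \<Omega> V"
    proof (rule ccontr)
      assume "\<not> 1 \<le> Linf_norm \<Omega> V"
      then obtain c where c: "0 \<le> c" "c < 1" "Linf_norm \<Omega> V = ennreal c"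
        by (cases "Linf_norm \<Omega> V") (auto simp: not_le)
      have Vle: "\<bar>V x\<bar> \<le> c" if "x \<in> \<Omega>" for x
        using Linf_norm_le_imp_le[OF \<Omega>(1) continuous_on_subset[OF Vc closure_subset] _ c(1) that] c(3) by simp
      have "(1 - c) / 2 > 0" using c by simp
      from uniform_limitD[OF seq\<Omega> this] obtain N
        where N: "\<forall>x\<in>\<Omega>. dist (v (s N) x) (V x) < (1 - c) / 2" unfolding eventually_sequentially by blast
      obtain x where x: "x \<in> \<Omega>" "(1 + c) / 2 < v (s N) x"
        using vbig[OF s, of "(1 + c) / 2" N] c by auto
      have "\<bar>v (s N) x - V x\<bar> < (1 - c) / 2" using N x(1) by (simp add: dist_real_def)
      then show False using x(2) Vle[OF x(1)] by argo
    qed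
  qed
  have W: "W1inf0 \<Omega> V"
    unfolding W1inf0_def
    by (intro conjI exI[of _ V] lipschitz_W1inf[OF \<Omega> glip] Vc ballI Vfr) simp_all
  have maximal: "u x \<le> V x"
    if u: "dirichlet_solution \<Omega> 1 u" "Linf_norm \<Omega> u = 1" and x: "x \<in> closure \<Omega>" for u x
  proof (rule LIMSEQ_le_const[OF ptw[OF x]])
    have "u x \<le> v (s n) x" for n
      by (rule comparison[OF \<Omega> \<Lambda>[unfolded \<Lambda>_def] u(1) dirichlet_solution_bounds(1)[OF \<Omega>(1) u] v[OF s] vpos[OF s] s _ x])
         (use s(2)[of n] in auto)
    then show "\<exists>N. \<forall>n\<ge>N. u x \<le> v (s n) x" by blast
  qed
  show ?thesis
  proof (intro exI[of _ V] conjI allI impI ballI W Vc unif dir Vnorm)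
    fix u x assume "dirichlet_solution \<Omega> 1 u \<and> Linf_norm \<Omega> u = 1" "x \<in> closure \<Omega>"
    then show "u x \<le> V x" using maximal by blast
  qed
qed

end
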